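(* For each $n$, there are $n$ quadrics $f_1,\ldots,f_n$ in $\mathbb{R}^2$ such that $$\#\{\text{bounded regions of }V_{\mathbb{R}}\}\ =\ \text{ML degree of }{\bf f}\ =\ 2n^2-2n+1.$$ Hence all critical points are real.
   Context: Quadrics in $\mathbb{R}^2$ are polynomials of degree $2$ in $\theta_1,\theta_2$ with real coefficients; $n\ge1$. $V_{\mathbb{R}}=\mathbb{R}^2\setminus\bigcup_{i=1}^n\{f_i=0\}$; a bounded region is a connected component of $V_{\mathbb{R}}$ that is bounded in $\mathbb{R}^2$. The ML degree of ${\bf f}=(f_1,\ldots,f_n)$ is the number, counted with multiplicity, of points $\theta\in\mathbb{C}^2$ with all $f_i(\theta)\ne0$ satisfying the critical equations $\sum_{i=1}^n\frac{u_i}{f_i}\frac{\partial f_i}{\partial\theta_j}=0$, $j=1,2$, for a general vector $u=(u_1,\ldots,u_n)$ of positive integers; these points are the critical points referred to. *)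

theory Defs
  imports
    "HOL-Analysis.Analysis"
    "HOL-Computational_Algebra.Polynomial"
    "HOL-Computational_Algebra.Fraction_Field"
    "HOL-Library.Poly_Mapping"
begin

(* A polynomial in theta_1, theta_2 over K is an element of K[theta_1][theta_2]:
   the outer variable is theta_2, the coefficients are polynomials in theta_1. *)
type_synonym 'a poly2 = "'a poly poly"

definition eval2 :: "'a::comm_ring_1 poly2 \<Rightarrow> 'a \<times> 'a \<Rightarrow> 'a" where
  "eval2 p \<theta> = poly (poly p [:snd \<theta>:]) (fst \<theta>)"

definition total_degree :: "'a::zero poly2 \<Rightarrow> nat" where
  "total_degree p = Max (insert 0 {i + j | i j. coeff (coeff p j) i \<noteq> 0})"

definition quadric :: "real poly2 \<Rightarrow> bool" where
  "quadric p \<longleftrightarrow> total_degree p = 2"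

definition partial1 :: "'a::{comm_semiring_1,semiring_no_zero_divisors} poly2 \<Rightarrow> 'a poly2" where
  "partial1 p = map_poly pderiv p"

definition partial2 :: "'a::{comm_semiring_1,semiring_no_zero_divisors} poly2 \<Rightarrow> 'a poly2" where
  "partial2 p = pderiv p"

definition complexify :: "real poly2 \<Rightarrow> complex poly2" where
  "complexify p = map_poly (map_poly complex_of_real) p"

definition V_real :: "nat \<Rightarrow> (nat \<Rightarrow> real poly2) \<Rightarrow> (real \<times> real) set" where
  "V_real n f = UNIV - (\<Union>i\<in>{1..n}. {\<theta>. eval2 (f i) \<theta> = 0})"

definition bounded_regions :: "nat \<Rightarrow> (nat \<Rightarrow> real poly2) \<Rightarrow> (real \<times> real) set set" where
  "bounded_regions n f = {R \<in> components (V_real n f). bounded R}"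

definition critical_points ::
    "nat \<Rightarrow> (nat \<Rightarrow> real poly2) \<Rightarrow> (nat \<Rightarrow> nat) \<Rightarrow> (complex \<times> complex) set" where
  "critical_points n f u = {\<theta>.
     (\<forall>i\<in>{1..n}. eval2 (complexify (f i)) \<theta> \<noteq> 0) \<and>
     (\<Sum>i\<in>{1..n}. of_nat (u i) / eval2 (complexify (f i)) \<theta>
        * eval2 (partial1 (complexify (f i))) \<theta>) = 0 \<and>
     (\<Sum>i\<in>{1..n}. of_nat (u i) / eval2 (complexify (f i)) \<theta>
        * eval2 (partial2 (complexify (f i))) \<theta>) = 0}"

(* The left-hand sides of the critical equations as elements of the rational
   function field C(theta_1, theta_2); D is partial1 or partial2. *)
definition critical_function ::
    "(complex poly2 \<Rightarrow> complex poly2) \<Rightarrow> nat \<Rightarrow> (nat \<Rightarrow> real poly2) \<Rightarrow> (nat \<Rightarrow> nat) \<Rightarrow>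
      complex poly2 fract" where
  "critical_function D n f u =
     (\<Sum>i\<in>{1..n}. of_nat (u i) * Fract (D (complexify (f i))) (complexify (f i)))"

(* The local ring of the affine plane at theta, inside the rational function field. *)
definition local_ring :: "complex \<times> complex \<Rightarrow> complex poly2 fract set" where
  "local_ring \<theta> = {Fract a b | a b. eval2 b \<theta> \<noteq> 0}"

(* The ideal of the local ring generated by g and h, for g and h in that ring. *)
definition local_ideal ::
    "complex \<times> complex \<Rightarrow> complex poly2 fract \<Rightarrow> complex poly2 fract \<Rightarrow> complex poly2 fract set" where
  "local_ideal \<theta> g h = {a * g + b * h | a b. a \<in> local_ring \<theta> \<and> b \<in> local_ring \<theta>}"

definition const_fract :: "complex \<Rightarrow> complex poly2 fract" where
  "const_fract c = Fract [:[:c:]:] 1"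

(* The complex vector space V / W is finite-dimensional of dimension d: the classes
   of b 0, ..., b (d - 1) form a basis of it. *)
definition has_quotient_dim ::
    "complex poly2 fract set \<Rightarrow> complex poly2 fract set \<Rightarrow> nat \<Rightarrow> bool" where
  "has_quotient_dim V W d \<longleftrightarrow> (\<exists>b. (\<forall>i<d. b i \<in> V) \<and>
     (\<forall>v\<in>V. \<exists>c. v - (\<Sum>i<d. const_fract (c i) * b i) \<in> W) \<and>
     (\<forall>c. (\<Sum>i<d. const_fract (c i) * b i) \<in> W \<longrightarrow> (\<forall>i<d. c i = 0)))"

(* Multiplicity of a solution of the critical equations: the length of the local
   ring modulo the two equations. *)
definition has_multiplicity ::
    "nat \<Rightarrow> (nat \<Rightarrow> real poly2) \<Rightarrow> (nat \<Rightarrow> nat) \<Rightarrow> complex \<times> complex \<Rightarrow> nat \<Rightarrow> bool" where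
  "has_multiplicity n f u \<theta> d \<longleftrightarrow>
     has_quotient_dim (local_ring \<theta>)
       (local_ideal \<theta> (critical_function partial1 n f u) (critical_function partial2 n f u)) d"

definition has_critical_count ::
    "nat \<Rightarrow> (nat \<Rightarrow> real poly2) \<Rightarrow> (nat \<Rightarrow> nat) \<Rightarrow> nat \<Rightarrow> bool" where
  "has_critical_count n f u d \<longleftrightarrow> finite (critical_points n f u) \<and>
     (\<exists>\<mu>. (\<forall>\<theta>\<in>critical_points n f u. has_multiplicity n f u \<theta> (\<mu> \<theta>)) \<and>
       (\<Sum>\<theta>\<in>critical_points n f u. \<mu> \<theta>) = d)"

definition eval_weights :: "((nat \<Rightarrow>\<^sub>0 nat) \<Rightarrow>\<^sub>0 complex) \<Rightarrow> (nat \<Rightarrow> nat) \<Rightarrow> complex" where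
  "eval_weights P u = (\<Sum>m\<in>Poly_Mapping.keys P. Poly_Mapping.lookup P m *
     (\<Prod>i\<in>Poly_Mapping.keys m. of_nat (u i) ^ Poly_Mapping.lookup m i))"

(* Q holds for general (u_1, ..., u_n): for all vectors of positive integers off the
   zero set of some nonzero polynomial P in n variables. Such vectors are Zariski dense
   in C^n, so two properties holding for general u hold simultaneously for some u. *)
definition for_general_weights :: "nat \<Rightarrow> ((nat \<Rightarrow> nat) \<Rightarrow> bool) \<Rightarrow> bool" where
  "for_general_weights n Q \<longleftrightarrow> (\<exists>P :: (nat \<Rightarrow>\<^sub>0 nat) \<Rightarrow>\<^sub>0 complex.
     P \<noteq> 0 \<and> (\<forall>m\<in>Poly_Mapping.keys P. Poly_Mapping.keys m \<subseteq> {1..n}) \<and>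
     (\<forall>u. (\<forall>i\<in>{1..n}. 0 < u i) \<and> eval_weights P u \<noteq> 0 \<longrightarrow> Q u))"

(* A relation rather than a function, so that it includes the existence of the
   common value for general u; that value is unique by the density noted above. *)
definition has_ML_degree :: "nat \<Rightarrow> (nat \<Rightarrow> real poly2) \<Rightarrow> nat \<Rightarrow> bool" where
  "has_ML_degree n f d \<longleftrightarrow> for_general_weights n (\<lambda>u. has_critical_count n f u d)"

end

theory Submission
  imports Defs
begin

text \<open>
  The quadrics are the ellipses \<open>t\<^sup>2 x\<^sup>2 + y\<^sup>2 = t\<close> for \<open>t = 1, \<dots>, n\<close>. In the coordinates
  \<open>X = x\<^sup>2\<close>, \<open>Y = y\<^sup>2\<close> they become the lines \<open>L\<^sub>t = t\<^sup>2 X + Y - t = 0\<close>. Read as a function of \<open>t\<close>,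
  \<open>L\<^sub>t\<close> is a quadratic polynomial, which is convex when \<open>X \<ge> 0\<close>. So at a point of the closed
  quadrant the indices with \<open>L\<^sub>t < 0\<close> form an interval.

  Regions. For each nonempty interval \<open>{j..k}\<close> of indices the points of the quadrant with exactly these lines
  negative form a nonempty convex chamber. It reaches the axis \<open>X = 0\<close> exactly if \<open>k = n\<close>, and the
  axis \<open>Y = 0\<close> exactly if \<open>j = 1\<close>. Unfolding the quadrant to the plane glues the copies of the
  chamber along the axes that it reaches, and doubles the chamber across each axis that it misses.
  Recording \<open>n - k\<close> and \<open>j - 1\<close> with the signs of \<open>x\<close> and \<open>y\<close>, one finds that these bounded regions
  are indexed by the integer points \<open>(p, q)\<close> with \<open>\<bar>p\<bar> + \<bar>q\<bar> < n\<close>, of which there are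
  \<open>2 n\<^sup>2 - 2 n + 1\<close> (\<open>components_ellipses\<close>, \<open>card_diamond\<close>). The only other region is the unbounded
  one outside all ellipses.

  Critical points. Let \<open>A = \<Sum>t. u\<^sub>t t\<^sup>2 / L\<^sub>t\<close> and \<open>B = \<Sum>t. u\<^sub>t / L\<^sub>t\<close>. The critical equations are
  \<open>x A = 0\<close> and \<open>y B = 0\<close>. Let \<open>u\<close> be any vector of positive integers.
  \<^item> Every critical point is real. Taking imaginary parts of \<open>A\<close> and \<open>B\<close> yields
    \<open>\<Sum>t. u\<^sub>t (t\<^sup>2 Im X + Im Y)\<^sup>2 / \<bar>L\<^sub>t\<bar>\<^sup>2 = 0\<close>, so \<open>X\<close> and \<open>Y\<close> are real (\<open>critical_imp_real\<close>). They are
    nonnegative by a Chebyshev type inequality: if \<open>L\<^sub>t\<close> changes sign at most once along \<open>1, \<dots>, n\<close>,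
    then \<open>A\<close> and \<open>B\<close> cannot both vanish (\<open>one_sign_change_sum\<close>).
  \<^item> Each bounded region contains exactly one critical point, and the unbounded one contains none.
    Existence comes from maximizing \<open>\<Prod>t. \<bar>L\<^sub>t\<bar> ^ u\<^sub>t\<close> on the closure; uniqueness from the concavity of
    \<open>\<Sum>t. u\<^sub>t log \<bar>L\<^sub>t\<bar>\<close> in \<open>(X, Y)\<close> on a chamber.
  \<^item> Each critical point is simple: the Jacobian determinant of the equations is nonzero by the
    Cauchy-Schwarz inequality (\<open>simple_critical_det\<close>), so they generate the maximal ideal of
    the local ring (\<open>simple_zero_quotient_dim\<close>).

  Hence critical points correspond to bounded regions, each with multiplicity 1, for all positive
  weights and in particular for general ones.
\<close>

section \<open>The local ring at a point and simple zeros\<close>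

lemma eval2_simps [simp]:
  "eval2 (p + q) \<theta> = eval2 p \<theta> + eval2 q \<theta>"
  "eval2 (p * q) \<theta> = eval2 p \<theta> * eval2 q \<theta>"
  "eval2 0 \<theta> = 0" "eval2 1 \<theta> = 1" "eval2 [:[:c:]:] \<theta> = c"
  by (simp_all add: eval2_def)

text \<open>
  Evaluation at \<open>\<theta>\<close> is a relation rather than a function because a fraction may have a representation
  whose denominator vanishes at \<open>\<theta>\<close> as well as one whose denominator does not.
\<close>

definition has_value :: "complex \<times> complex \<Rightarrow> complex poly2 fract \<Rightarrow> complex \<Rightarrow> bool" where
  "has_value \<theta> v c \<longleftrightarrow> (\<exists>a b. v = Fract a b \<and> eval2 b \<theta> \<noteq> 0 \<and> c = eval2 a \<theta> / eval2 b \<theta>)"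

lemma local_ring_iff_has_value: "v \<in> local_ring \<theta> \<longleftrightarrow> (\<exists>c. has_value \<theta> v c)"
  by (auto simp: local_ring_def has_value_def)

lemma has_value_unique:
  assumes "has_value \<theta> v c" "has_value \<theta> v d"
  shows "c = d"
proof -
  obtain a b where ab: "v = Fract a b" "eval2 b \<theta> \<noteq> 0" "c = eval2 a \<theta> / eval2 b \<theta>"
    using assms(1) by (auto simp: has_value_def)
  obtain a' b' where ab': "v = Fract a' b'" "eval2 b' \<theta> \<noteq> 0" "d = eval2 a' \<theta> / eval2 b' \<theta>"
    using assms(2) by (auto simp: has_value_def)
  have "b \<noteq> 0" "b' \<noteq> 0" using ab(2) ab'(2) by auto
  hence "a * b' = a' * b" using ab(1) ab'(1) by (simp add: eq_fract)
  hence "eval2 a \<theta> * eval2 b' \<theta> = eval2 a' \<theta> * eval2 b \<theta>"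
    by (metis eval2_simps(2))
  thus ?thesis using ab ab' by (simp add: frac_eq_eq)
qed

lemma has_value_add:
  assumes "has_value \<theta> v c" "has_value \<theta> w d" shows "has_value \<theta> (v + w) (c + d)"
proof -
  obtain a b where ab: "v = Fract a b" "eval2 b \<theta> \<noteq> 0" "c = eval2 a \<theta> / eval2 b \<theta>"
    using assms(1) by (auto simp: has_value_def)
  obtain a' b' where ab': "w = Fract a' b'" "eval2 b' \<theta> \<noteq> 0" "d = eval2 a' \<theta> / eval2 b' \<theta>"
    using assms(2) by (auto simp: has_value_def)
  have "b \<noteq> 0" "b' \<noteq> 0" using ab(2) ab'(2) by auto
  hence "v + w = Fract (a * b' + a' * b) (b * b')" using ab(1) ab'(1) by simp
  moreover have "c + d = eval2 (a * b' + a' * b) \<theta> / eval2 (b * b') \<theta>"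
    using ab ab' by (simp add: add_frac_eq)
  ultimately show ?thesis using ab(2) ab'(2) unfolding has_value_def
    by (metis eval2_simps(2) no_zero_divisors)
qed

lemma has_value_mult:
  assumes "has_value \<theta> v c" "has_value \<theta> w d" shows "has_value \<theta> (v * w) (c * d)"
proof -
  obtain a b where ab: "v = Fract a b" "eval2 b \<theta> \<noteq> 0" "c = eval2 a \<theta> / eval2 b \<theta>"
    using assms(1) by (auto simp: has_value_def)
  obtain a' b' where ab': "w = Fract a' b'" "eval2 b' \<theta> \<noteq> 0" "d = eval2 a' \<theta> / eval2 b' \<theta>"
    using assms(2) by (auto simp: has_value_def)
  have "v * w = Fract (a * a') (b * b')" using ab(1) ab'(1) by simp
  moreover have "c * d = eval2 (a * a') \<theta> / eval2 (b * b') \<theta>"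
    using ab ab' by simp
  ultimately show ?thesis using ab(2) ab'(2) unfolding has_value_def
    by (metis eval2_simps(2) no_zero_divisors)
qed

lemma has_value_inverse:
  assumes "has_value \<theta> v c" "c \<noteq> 0" shows "has_value \<theta> (inverse v) (inverse c)"
proof -
  obtain a b where ab: "v = Fract a b" "eval2 b \<theta> \<noteq> 0" "c = eval2 a \<theta> / eval2 b \<theta>"
    using assms(1) by (auto simp: has_value_def)
  have "inverse v = Fract b a" "eval2 a \<theta> \<noteq> 0" "inverse c = eval2 b \<theta> / eval2 a \<theta>"
    using ab assms(2) by auto
  thus ?thesis unfolding has_value_def by blast
qed

lemma has_value_poly: "has_value \<theta> (Fract p 1) (eval2 p \<theta>)"
  unfolding has_value_def by (rule exI[of _ p], rule exI[of _ 1]) simp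

lemma has_value_const: "has_value \<theta> (const_fract c) c"
  using has_value_poly[of \<theta> "[:[:c:]:]"] by (simp add: const_fract_def)

lemma const_fract_hom:
  "const_fract 0 = 0" "const_fract 1 = 1"
  "const_fract (a + b) = const_fract a + const_fract b"
  "const_fract (a - b) = const_fract a - const_fract b"
  "const_fract (a * b) = const_fract a * const_fract b"
  by (simp_all add: const_fract_def Zero_fract_def One_fract_def flip: one_pCons)

lemma const_fract_uminus: "const_fract (- a) = - const_fract a"
  using const_fract_hom(4)[of 0 a] by (simp add: const_fract_hom)

lemma const_fract_inverse: "const_fract (inverse a) = inverse (const_fract a)"
proof (cases "a = 0")
  case False
  hence "const_fract a * const_fract (inverse a) = 1"
    by (simp add: const_fract_hom(2) flip: const_fract_hom(5))
  thus ?thesis by (metis inverse_unique)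
qed (simp add: const_fract_hom)

lemma const_fract_divide: "const_fract (a / b) = const_fract a / const_fract b"
  by (simp add: divide_inverse const_fract_hom const_fract_inverse)

lemma const_fract_of_nat: "const_fract (of_nat k) = of_nat k"
  by (induction k) (simp_all add: const_fract_hom)

lemma const_fract_power: "const_fract (a ^ k) = const_fract a ^ k"
  by (induction k) (simp_all add: const_fract_hom)

lemma const_fract_sum: "const_fract (\<Sum>i\<in>I. g i) = (\<Sum>i\<in>I. const_fract (g i))"
  by (induction I rule: infinite_finite_induct) (simp_all add: const_fract_hom)

lemma has_value_uminus: "has_value \<theta> v c \<Longrightarrow> has_value \<theta> (- v) (- c)"
  using has_value_mult[OF has_value_const[of \<theta> "-1"], of v c]
  by (simp add: const_fract_uminus const_fract_hom)

lemma has_value_diff: "has_value \<theta> v c \<Longrightarrow> has_value \<theta> w d \<Longrightarrow> has_value \<theta> (v - w) (c - d)"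
  using has_value_add[of \<theta> v c "- w" "- d"] has_value_uminus[of \<theta> w d] by simp

lemma has_value_divide:
  "has_value \<theta> v c \<Longrightarrow> has_value \<theta> w d \<Longrightarrow> d \<noteq> 0 \<Longrightarrow> has_value \<theta> (v / w) (c / d)"
  by (simp add: divide_inverse has_value_mult has_value_inverse)

lemma has_value_of_nat: "has_value \<theta> (of_nat k) (of_nat k)"
  by (metis const_fract_of_nat has_value_const)

lemma has_value_numeral: "has_value \<theta> (numeral k) (numeral k)"
  by (metis has_value_of_nat of_nat_numeral)

lemma has_value_power: "has_value \<theta> v c \<Longrightarrow> has_value \<theta> (v ^ k) (c ^ k)"
  by (induction k)
     (use has_value_mult has_value_of_nat[of \<theta> 1] in auto)

lemma has_value_sum:
  "(\<And>i. i \<in> I \<Longrightarrow> has_value \<theta> (g i) (c i)) \<Longrightarrow> has_value \<theta> (\<Sum>i\<in>I. g i) (\<Sum>i\<in>I. c i)"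
proof (induction I rule: infinite_finite_induct)
  case (insert i I)
  then show ?case by (simp add: has_value_add)
qed (use has_value_of_nat[of \<theta> 0] in auto)

definition coord1 :: "complex poly2 fract" where "coord1 = Fract [:[:0, 1:]:] 1"
definition coord2 :: "complex poly2 fract" where "coord2 = Fract [:0, 1:] 1"

lemma has_value_coord: "has_value \<theta> coord1 (fst \<theta>)" "has_value \<theta> coord2 (snd \<theta>)"
  using has_value_poly[of \<theta> "[:[:0, 1:]:]"] has_value_poly[of \<theta> "[:0, 1:]"]
  by (simp_all add: coord1_def coord2_def eval2_def)

lemmas has_value_intros = has_value_add has_value_diff has_value_uminus has_value_mult
  has_value_divide has_value_of_nat has_value_numeral has_value_power has_value_sum
  has_value_const has_value_coord

text \<open>
  The maximal ideal of the local ring is generated by the two coordinate differences: divide the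
  numerator by \<open>\<theta>\<^sub>2 - snd \<theta>\<close>, then the remainder, a polynomial in \<open>\<theta>\<^sub>1\<close> alone, by \<open>\<theta>\<^sub>1 - fst \<theta>\<close>.
\<close>

lemma vanishing_in_coordinate_ideal:
  assumes "has_value \<theta> v 0"
  obtains r s where "r \<in> local_ring \<theta>" "s \<in> local_ring \<theta>"
    "v = (coord1 - const_fract (fst \<theta>)) * r + (coord2 - const_fract (snd \<theta>)) * s"
proof -
  obtain a b where ab: "v = Fract a b" "eval2 b \<theta> \<noteq> 0" "eval2 a \<theta> = 0"
    using assms by (auto simp: has_value_def)
  define r where "r = poly a [:snd \<theta>:]"
  have "poly (a - [:r:]) [:snd \<theta>:] = 0" by (simp add: r_def)
  then obtain q where q: "a - [:r:] = [:- [:snd \<theta>:], 1:] * q"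
    unfolding poly_eq_0_iff_dvd by (rule dvdE)
  have "poly r (fst \<theta>) = 0" using ab(3) by (simp add: r_def eval2_def)
  then obtain s where s: "r = [:- fst \<theta>, 1:] * s"
    unfolding poly_eq_0_iff_dvd by (rule dvdE)
  have a: "a = [:[:- fst \<theta>, 1:]:] * [:s:] + [:- [:snd \<theta>:], 1:] * q"
    using q s by (simp add: algebra_simps)
  have c1: "coord1 - const_fract (fst \<theta>) = Fract [:[:- fst \<theta>, 1:]:] 1"
    by (simp add: coord1_def const_fract_def)
  have c2: "coord2 - const_fract (snd \<theta>) = Fract [:- [:snd \<theta>:], 1:] 1"
    by (simp add: coord2_def const_fract_def flip: one_pCons)
  have "v = Fract a 1 * Fract 1 b" using ab(1) by simp
  also have "Fract a 1 = Fract [:[:- fst \<theta>, 1:]:] 1 * Fract [:s:] 1 + Fract [:- [:snd \<theta>:], 1:] 1 * Fract q 1"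
    by (subst a) (simp only: mult_fract add_fract mult_1 mult_1_right one_neq_zero not_False_eq_True)
  finally have "v = (coord1 - const_fract (fst \<theta>)) * (Fract [:s:] 1 * Fract 1 b)
      + (coord2 - const_fract (snd \<theta>)) * (Fract q 1 * Fract 1 b)"
    unfolding c1 c2 by (simp only: distrib_right mult.assoc)
  moreover have "Fract [:s:] 1 * Fract 1 b \<in> local_ring \<theta>" "Fract q 1 * Fract 1 b \<in> local_ring \<theta>"
    using ab(2) by (auto simp: local_ring_def)
  ultimately show ?thesis using that by blast
qed

lemma local_ring_mult: "v \<in> local_ring \<theta> \<Longrightarrow> w \<in> local_ring \<theta> \<Longrightarrow> v * w \<in> local_ring \<theta>"
  and local_ring_add: "v \<in> local_ring \<theta> \<Longrightarrow> w \<in> local_ring \<theta> \<Longrightarrow> v + w \<in> local_ring \<theta>"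
  and local_ring_diff: "v \<in> local_ring \<theta> \<Longrightarrow> w \<in> local_ring \<theta> \<Longrightarrow> v - w \<in> local_ring \<theta>"
  unfolding local_ring_iff_has_value using has_value_mult has_value_add has_value_diff by blast+

text \<open>
  The Jacobian criterion. The matrix expressing \<open>g\<close> and \<open>h\<close> in the coordinate differences is
  invertible over the local ring, because its determinant has a nonzero value. So \<open>g\<close> and \<open>h\<close> generate
  the maximal ideal, and the quotient is the residue field.
\<close>

lemma simple_zero_quotient_dim:
  fixes \<theta> :: "complex \<times> complex"
  defines "x \<equiv> coord1 - const_fract (fst \<theta>)" and "y \<equiv> coord2 - const_fract (snd \<theta>)"
  assumes vals: "has_value \<theta> \<alpha> a" "has_value \<theta> \<beta> b" "has_value \<theta> \<gamma> c" "has_value \<theta> \<delta> d"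
    and det: "a * d - b * c \<noteq> 0"
    and g: "g = x * \<alpha> + y * \<beta>" and h: "h = x * \<gamma> + y * \<delta>"
  shows "has_quotient_dim (local_ring \<theta>) (local_ideal \<theta> g h) 1"
proof -
  have xy: "has_value \<theta> x 0" "has_value \<theta> y 0"
    using has_value_diff[OF has_value_coord(1) has_value_const[of \<theta> "fst \<theta>"]]
      has_value_diff[OF has_value_coord(2) has_value_const[of \<theta> "snd \<theta>"]]
    by (simp_all add: x_def y_def)
  have gh: "has_value \<theta> g 0" "has_value \<theta> h 0"
    using has_value_add[OF has_value_mult[OF xy(1) vals(1)] has_value_mult[OF xy(2) vals(2)]]
      has_value_add[OF has_value_mult[OF xy(1) vals(3)] has_value_mult[OF xy(2) vals(4)]]
    by (simp_all add: g h)
  define \<Delta> where "\<Delta> = \<alpha> * \<delta> - \<beta> * \<gamma>"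
  have D: "has_value \<theta> \<Delta> (a * d - b * c)"
    unfolding \<Delta>_def using vals by (intro has_value_intros)
  have "\<Delta> \<noteq> 0"
    using has_value_unique[OF D, of 0] has_value_of_nat[of \<theta> 0] det by fastforce
  have Di: "inverse \<Delta> \<in> local_ring \<theta>"
    using has_value_inverse[OF D det] local_ring_iff_has_value by blast
  have L: "\<alpha> \<in> local_ring \<theta>" "\<beta> \<in> local_ring \<theta>" "\<gamma> \<in> local_ring \<theta>" "\<delta> \<in> local_ring \<theta>"
    using vals local_ring_iff_has_value by blast+
  \<comment> \<open>Cramer's rule\<close>
  have "x * \<Delta> = \<delta> * g - \<beta> * h" "y * \<Delta> = \<alpha> * h - \<gamma> * g"
    by (simp_all add: g h \<Delta>_def algebra_simps)
  hence x: "x = inverse \<Delta> * (\<delta> * g - \<beta> * h)" and y: "y = inverse \<Delta> * (\<alpha> * h - \<gamma> * g)"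
    using \<open>\<Delta> \<noteq> 0\<close> by (simp_all add: field_simps)
  have max_le: "v \<in> local_ideal \<theta> g h" if v: "has_value \<theta> v 0" for v
  proof -
    obtain r s where rs: "r \<in> local_ring \<theta>" "s \<in> local_ring \<theta>" "v = x * r + y * s"
      using vanishing_in_coordinate_ideal[OF v] unfolding x_def y_def by blast
    have "v = (inverse \<Delta> * (\<delta> * r - \<gamma> * s)) * g + (inverse \<Delta> * (\<alpha> * s - \<beta> * r)) * h"
      unfolding rs(3) by (subst x, subst y) (simp add: algebra_simps)
    moreover have "inverse \<Delta> * (\<delta> * r - \<gamma> * s) \<in> local_ring \<theta>"
        "inverse \<Delta> * (\<alpha> * s - \<beta> * r) \<in> local_ring \<theta>"
      using L Di rs(1,2) by (simp_all add: local_ring_mult local_ring_diff)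
    ultimately show ?thesis unfolding local_ideal_def by blast
  qed
  have ideal_le: "has_value \<theta> v 0" if v: "v \<in> local_ideal \<theta> g h" for v
  proof -
    obtain p q where "v = p * g + q * h" "p \<in> local_ring \<theta>" "q \<in> local_ring \<theta>"
      using v unfolding local_ideal_def by blast
    moreover then obtain p' q' where "has_value \<theta> p p'" "has_value \<theta> q q'"
      unfolding local_ring_iff_has_value by blast
    ultimately show ?thesis
      using has_value_add[OF has_value_mult[OF _ gh(1)] has_value_mult[OF _ gh(2)]] by fastforce
  qed
  have one: "has_value \<theta> 1 1" using has_value_of_nat[of \<theta> 1] by simp
  have span: "\<exists>c. v - (\<Sum>i<1::nat. const_fract (c i) * 1) \<in> local_ideal \<theta> g h"
    if v: "v \<in> local_ring \<theta>" for v
  proof -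
    obtain e where "has_value \<theta> v e" using v local_ring_iff_has_value by blast
    hence "has_value \<theta> (v - const_fract e) 0"
      using has_value_diff[OF _ has_value_const, of \<theta> v e e] by simp
    hence "v - (\<Sum>i<1::nat. const_fract ((\<lambda>_. e) i) * 1) \<in> local_ideal \<theta> g h"
      using max_le by simp
    thus ?thesis by (rule exI[of _ "\<lambda>_. e"])
  qed
  have indep: "e 0 = 0" if "(\<Sum>i<1::nat. const_fract (e i) * 1) \<in> local_ideal \<theta> g h" for e :: "nat \<Rightarrow> complex"
  proof -
    have "has_value \<theta> (const_fract (e 0)) 0" using ideal_le[OF that] by simp
    thus ?thesis using has_value_unique has_value_const by blast
  qed
  show ?thesis unfolding has_quotient_dim_def
    by (rule exI[of _ "\<lambda>_. 1"]) (use span indep one local_ring_iff_has_value in auto)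
qed

section \<open>Weighted sums of reciprocals over the lines\<close>

definition line :: "nat \<Rightarrow> 'a::comm_ring_1 \<Rightarrow> 'a \<Rightarrow> 'a" where
  "line t X Y = of_nat t ^ 2 * X + Y - of_nat t"

text \<open>
  For \<open>k = 2\<close> and \<open>k = 0\<close> these are the two partial derivatives of \<open>\<Sum>t. u\<^sub>t log L\<^sub>t\<close> with respect to
  \<open>X\<close> and \<open>Y\<close>.
\<close>

definition weighted_sum :: "nat \<Rightarrow> (nat \<Rightarrow> nat) \<Rightarrow> nat \<Rightarrow> 'a::field \<Rightarrow> 'a \<Rightarrow> 'a" where
  "weighted_sum n u k X Y = (\<Sum>t\<in>{1..n}. of_nat (u t) * of_nat t ^ k / line t X Y)"

lemma line_of_real: "line t (complex_of_real a) (complex_of_real b) = complex_of_real (line t a b)"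
  by (simp add: line_def)

lemma weighted_sum_of_real:
  "weighted_sum n u k (complex_of_real a) (complex_of_real b) = complex_of_real (weighted_sum n u k a b)"
  by (simp add: weighted_sum_def line_of_real)

definition off_lines :: "nat \<Rightarrow> 'a::field \<Rightarrow> 'a \<Rightarrow> bool" where
  "off_lines n X Y \<longleftrightarrow> (\<forall>t\<in>{1..n}. line t X Y \<noteq> 0)"

lemma weighted_sum_pos:
  fixes X Y :: real
  assumes "n \<ge> 1" "\<forall>t\<in>{1..n}. 0 < u t" "\<forall>t\<in>{1..n}. line t X Y > 0"
  shows "weighted_sum n u k X Y > 0"
  unfolding weighted_sum_def using assms by (intro sum_pos) auto

lemma weighted_sum_neg:
  fixes X Y :: real
  assumes "n \<ge> 1" "\<forall>t\<in>{1..n}. 0 < u t" "\<forall>t\<in>{1..n}. line t X Y < 0"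
  shows "weighted_sum n u k X Y < 0"
proof -
  have "(\<Sum>t\<in>{1..n}. - (real (u t) * real t ^ k / line t X Y)) > 0"
    using assms by (intro sum_pos) (auto simp: divide_pos_neg)
  thus ?thesis unfolding weighted_sum_def sum_negf by simp
qed

text \<open>
  Passing from weights 1 to the increasing weights \<open>t\<^sup>2\<close> favours the negative terms, which come last.
  If \<open>m\<close> is the first index with \<open>d m < 0\<close>, then no term of \<open>\<Sum>t. (t\<^sup>2 - m\<^sup>2) d t\<close> is positive.
\<close>

lemma one_sign_change_sum:
  fixes d :: "nat \<Rightarrow> real"
  assumes nz: "\<And>t. t \<in> {1..n} \<Longrightarrow> d t \<noteq> 0"
    and once: "\<And>s t. s \<in> {1..n} \<Longrightarrow> t \<in> {1..n} \<Longrightarrow> s < t \<Longrightarrow> d s < 0 \<Longrightarrow> d t < 0"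
    and pos: "\<exists>t\<in>{1..n}. d t > 0" and neg: "\<exists>t\<in>{1..n}. d t < 0"
  shows "\<exists>c>0. (\<Sum>t\<in>{1..n}. real t ^ 2 * d t) < c * (\<Sum>t\<in>{1..n}. d t)"
proof -
  obtain s where s: "s \<in> {1..n}" "d s > 0" using pos by blast
  have ex: "\<exists>t. t \<in> {1..n} \<and> d t < 0" using neg by blast
  define m where "m = (LEAST t. t \<in> {1..n} \<and> d t < 0)"
  have m: "m \<in> {1..n}" "d m < 0" using LeastI_ex[OF ex] unfolding m_def by auto
  have below: "d t > 0" if "t \<in> {1..n}" "t < m" for t
    using not_less_Least[of t "\<lambda>t. t \<in> {1..n} \<and> d t < 0"] that nz[of t] unfolding m_def by force
  have above: "d t < 0" if "t \<in> {1..n}" "t > m" for t using once[of m t] m that by simp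
  have term_le: "(real t ^ 2 - real m ^ 2) * d t \<le> 0" if t: "t \<in> {1..n}" for t
  proof (cases "t < m")
    case True
    hence "real t ^ 2 \<le> real m ^ 2" by (intro power_mono) auto
    thus ?thesis using below[OF t True] by (simp add: mult_nonpos_nonneg)
  next
    case False
    hence "real m ^ 2 \<le> real t ^ 2" by (intro power_mono) auto
    thus ?thesis using above[OF t] False by (cases "t = m") (auto simp: mult_nonneg_nonpos)
  qed
  have "s < m" using above[of s] s m by (metis linorder_less_linear order_less_asym)
  hence "real s ^ 2 < real m ^ 2" by (intro power_strict_mono) auto
  hence "(real s ^ 2 - real m ^ 2) * d s < 0" using s by (simp add: mult_neg_pos)
  hence "(\<Sum>t\<in>{1..n}. (real t ^ 2 - real m ^ 2) * d t) < (\<Sum>t\<in>{1..n}. 0)"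
    using s term_le by (intro sum_strict_mono_ex1) auto
  hence "(\<Sum>t\<in>{1..n}. real t ^ 2 * d t) < real m ^ 2 * (\<Sum>t\<in>{1..n}. d t)"
    by (simp add: left_diff_distrib sum_subtractf sum_distrib_left)
  thus ?thesis using m by (intro exI[of _ "real m ^ 2"]) auto
qed

text \<open>
  If the values \<open>L\<^sub>t\<close> are not all negative, put \<open>d t = u\<^sub>t / L\<^sub>t\<close>. The vanishing of the sum of all \<open>d t\<close>
  rules out a constant sign, so there is exactly one sign change and \<open>one_sign_change_sum\<close> applies.
\<close>

lemma weighted_sum_2_neg_of_signs:
  fixes X Y :: real
  assumes n: "n \<ge> 1" and u: "\<forall>t\<in>{1..n}. 0 < u t" and off: "off_lines n X Y"
    and signs: "\<And>a b. a \<in> {1..n} \<Longrightarrow> b \<in> {1..n} \<Longrightarrow> a < b \<Longrightarrow> line a X Y < 0 \<Longrightarrow> line b X Y < 0"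
    and B: "(\<forall>t\<in>{1..n}. line t X Y < 0) \<or> weighted_sum n u 0 X Y = 0"
  shows "weighted_sum n u 2 X Y < 0"
proof (cases "\<forall>t\<in>{1..n}. line t X Y < 0")
  case True
  show ?thesis using weighted_sum_neg[OF n u True] .
next
  case False
  then obtain s where s: "s \<in> {1..n}" "line s X Y > 0" using off unfolding off_lines_def by force
  have Y: "weighted_sum n u 0 X Y = 0" using B False by blast
  define d where "d t = real (u t) / line t X Y" for t
  have d_sign: "d t > 0 \<longleftrightarrow> line t X Y > 0" "d t < 0 \<longleftrightarrow> line t X Y < 0" if "t \<in> {1..n}" for t
    using that u unfolding d_def by (auto simp: zero_less_divide_iff divide_less_0_iff)
  have "\<not> (\<forall>t\<in>{1..n}. line t X Y > 0)" using weighted_sum_pos[OF n u, of X Y 0] Y by auto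
  then obtain r where r: "r \<in> {1..n}" "line r X Y < 0" using off unfolding off_lines_def by force
  have "\<exists>c>0. (\<Sum>t\<in>{1..n}. real t ^ 2 * d t) < c * (\<Sum>t\<in>{1..n}. d t)"
  proof (rule one_sign_change_sum)
    show "d t \<noteq> 0" if "t \<in> {1..n}" for t
      using off d_sign[OF that] that unfolding off_lines_def by fastforce
    show "d b < 0" if "a \<in> {1..n}" "b \<in> {1..n}" "a < b" "d a < 0" for a b
      using signs[OF that(1,2,3)] d_sign that by simp
    show "\<exists>t\<in>{1..n}. 0 < d t" using s d_sign(1) by blast
    show "\<exists>t\<in>{1..n}. d t < 0" using r d_sign(2) by blast
  qed
  moreover have "(\<Sum>t\<in>{1..n}. d t) = 0" using Y by (simp add: weighted_sum_def d_def)
  ultimately have "(\<Sum>t\<in>{1..n}. real t ^ 2 * d t) < 0" by auto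
  thus ?thesis by (simp add: weighted_sum_def d_def mult.commute)
qed

text \<open>
  The mirror image of the preceding lemma, with \<open>d t = - u\<^sub>t / L\<^sub>t\<close>.
\<close>

lemma weighted_sum_0_neg_of_signs:
  fixes X Y :: real
  assumes n: "n \<ge> 1" and u: "\<forall>t\<in>{1..n}. 0 < u t" and off: "off_lines n X Y"
    and signs: "\<And>a b. a \<in> {1..n} \<Longrightarrow> b \<in> {1..n} \<Longrightarrow> a < b \<Longrightarrow> line a X Y > 0 \<Longrightarrow> line b X Y > 0"
    and A: "(\<forall>t\<in>{1..n}. line t X Y < 0) \<or> weighted_sum n u 2 X Y = 0"
  shows "weighted_sum n u 0 X Y < 0"
proof (cases "\<forall>t\<in>{1..n}. line t X Y < 0")
  case True
  show ?thesis using weighted_sum_neg[OF n u True] .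
next
  case False
  then obtain s where s: "s \<in> {1..n}" "line s X Y > 0" using off unfolding off_lines_def by force
  have A: "weighted_sum n u 2 X Y = 0" using A False by blast
  define d where "d t = - real (u t) / line t X Y" for t
  have d_sign: "d t > 0 \<longleftrightarrow> line t X Y < 0" "d t < 0 \<longleftrightarrow> line t X Y > 0" if "t \<in> {1..n}" for t
    using that u unfolding d_def by (auto simp: zero_less_divide_iff divide_less_0_iff)
  have "\<not> (\<forall>t\<in>{1..n}. line t X Y > 0)" using weighted_sum_pos[OF n u, of X Y 2] A by auto
  then obtain r where r: "r \<in> {1..n}" "line r X Y < 0" using off unfolding off_lines_def by force
  have "\<exists>c>0. (\<Sum>t\<in>{1..n}. real t ^ 2 * d t) < c * (\<Sum>t\<in>{1..n}. d t)"
  proof (rule one_sign_change_sum)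
    show "d t \<noteq> 0" if "t \<in> {1..n}" for t
      using off d_sign[OF that] that unfolding off_lines_def by fastforce
    show "d b < 0" if "a \<in> {1..n}" "b \<in> {1..n}" "a < b" "d a < 0" for a b
      using signs[OF that(1,2,3)] d_sign that by simp
    show "\<exists>t\<in>{1..n}. 0 < d t" using r d_sign(1) by blast
    show "\<exists>t\<in>{1..n}. d t < 0" using s d_sign(2) by blast
  qed
  moreover have "(\<Sum>t\<in>{1..n}. real t ^ 2 * d t) = - weighted_sum n u 2 X Y"
    by (simp add: weighted_sum_def d_def sum_negf mult.commute)
  moreover have "(\<Sum>t\<in>{1..n}. d t) = - weighted_sum n u 0 X Y"
    by (simp add: weighted_sum_def d_def sum_negf)
  ultimately show ?thesis using A by (auto simp: mult_less_0_iff)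
qed

text \<open>
  For \<open>X \<le> 0\<close> the value \<open>L\<^sub>t\<close> decreases with \<open>t\<close>, so it can only change from positive to negative.
  In view of the critical equation \<open>x A = 0\<close>, a critical point with \<open>X \<le> 0\<close> must have \<open>x = 0\<close>.
\<close>

lemma weighted_sum_2_neg:
  fixes X Y :: real
  assumes n: "n \<ge> 1" and u: "\<forall>t\<in>{1..n}. 0 < u t" and off: "off_lines n X Y"
    and X: "X \<le> 0" and B: "Y = 0 \<or> weighted_sum n u 0 X Y = 0"
  shows "weighted_sum n u 2 X Y < 0"
proof (rule weighted_sum_2_neg_of_signs[OF n u off])
  have sq: "real t ^ 2 * X \<le> 0" for t using X by (simp add: mult_nonneg_nonpos)
  show "line b X Y < 0" if "a < b" "line a X Y < 0" for a b
  proof -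
    have "(real b ^ 2 - real a ^ 2) * X \<le> 0"
      using that X by (intro mult_nonneg_nonpos) (auto intro: power_mono)
    thus ?thesis using that unfolding line_def by (simp add: algebra_simps)
  qed
  have "line t X Y < 0" if "Y = 0" "t \<in> {1..n}" for t
    using sq[of t] that by (simp add: line_def)
  thus "(\<forall>t\<in>{1..n}. line t X Y < 0) \<or> weighted_sum n u 0 X Y = 0" using B by blast
qed

text \<open>
  For \<open>Y \<le> 0\<close> a positive value of \<open>L\<^sub>t = t (t X - 1) + Y\<close> requires \<open>t X > 1\<close>, and from such an index on
  \<open>t (t X - 1)\<close> increases. So \<open>L\<^sub>t\<close> can only change from negative to positive.
\<close>

lemma weighted_sum_0_neg:
  fixes X Y :: real
  assumes n: "n \<ge> 1" and u: "\<forall>t\<in>{1..n}. 0 < u t" and off: "off_lines n X Y"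
    and Y: "Y \<le> 0" and A: "X = 0 \<or> weighted_sum n u 2 X Y = 0"
  shows "weighted_sum n u 0 X Y < 0"
proof (rule weighted_sum_0_neg_of_signs[OF n u off])
  show "line b X Y > 0" if "a \<in> {1..n}" "a < b" "line a X Y > 0" for a b
  proof -
    have ab: "0 < real a" "real a < real b" using that by auto
    have a: "0 < real a * (real a * X - 1) + Y"
      using that unfolding line_def by (simp add: algebra_simps power2_eq_square)
    hence "0 < real a * (real a * X - 1)" using Y by linarith
    hence pos: "0 < real a * X - 1" using ab by (simp add: zero_less_mult_iff)
    hence "0 < X" using ab by (smt (verit) mult_nonneg_nonpos)
    hence "real a * (real a * X - 1) \<le> real b * (real b * X - 1)"
      using ab pos by (intro mult_mono) (auto intro: order_less_imp_le)
    thus ?thesis using a unfolding line_def by (simp add: algebra_simps power2_eq_square)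
  qed
  have "line t X Y < 0" if "X = 0" "t \<in> {1..n}" for t
    using Y that by (simp add: line_def)
  thus "(\<forall>t\<in>{1..n}. line t X Y < 0) \<or> weighted_sum n u 2 X Y = 0" using A by blast
qed

lemma weighted_sum_one_nonzero:
  assumes "0 < u 1" "off_lines 1 X Y"
  shows "weighted_sum 1 u k X (Y :: 'a :: field_char_0) \<noteq> 0"
  using assms by (simp add: weighted_sum_def off_lines_def)

text \<open>
  Since \<open>Im (1 / L\<^sub>t) = - Im L\<^sub>t / \<bar>L\<^sub>t\<bar>\<^sup>2\<close> with \<open>Im L\<^sub>t = t\<^sup>2 Im X + Im Y\<close>, the combination
  \<open>Im X Im A + Im Y Im B\<close> is minus a sum of squares with positive weights. It vanishes at a critical
  point: a nonzero imaginary part of \<open>X\<close> forces \<open>X \<noteq> 0\<close> and hence \<open>A = 0\<close>, and likewise for \<open>Y\<close>.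
  All \<open>t\<^sup>2 Im X + Im Y\<close> are therefore zero, and two indices suffice to conclude. For \<open>n = 1\<close>
  the sums \<open>A\<close> and \<open>B\<close> are single nonzero terms, so that \<open>X = Y = 0\<close>.
\<close>

lemma critical_imp_real:
  fixes X Y :: complex
  assumes n: "n \<ge> 1" and u: "\<forall>t\<in>{1..n}. 0 < u t" and off: "off_lines n X Y"
    and A: "X = 0 \<or> weighted_sum n u 2 X Y = 0" and B: "Y = 0 \<or> weighted_sum n u 0 X Y = 0"
  shows "Im X = 0 \<and> Im Y = 0"
proof (cases "n = 1")
  case True
  thus ?thesis using A B weighted_sum_one_nonzero[of u X Y] off u by auto
next
  case False
  have Im_ws: "Im (weighted_sum n u k X Y) =
      - (\<Sum>t\<in>{1..n}. real (u t) * real t ^ k * (real t ^ 2 * Im X + Im Y) / cmod (line t X Y) ^ 2)" for k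
    unfolding weighted_sum_def Im_sum sum_negf[symmetric]
  proof (intro sum.cong refl)
    fix t
    have i: "Im (line t X Y) = real t ^ 2 * Im X + Im Y"
      by (simp add: line_def flip: of_nat_power)
    have "of_nat (u t) * of_nat t ^ k = complex_of_real (real (u t) * real t ^ k)" by simp
    thus "Im (of_nat (u t) * of_nat t ^ k / line t X Y) =
        - (real (u t) * real t ^ k * (real t ^ 2 * Im X + Im Y) / (cmod (line t X Y))\<^sup>2)"
      by (simp only: Im_divide Re_complex_of_real Im_complex_of_real cmod_power2 i) simp
  qed
  have "Im X * Im (weighted_sum n u 2 X Y) + Im Y * Im (weighted_sum n u 0 X Y) = 0"
    using A B by auto
  hence "(\<Sum>t\<in>{1..n}. real (u t) * (real t ^ 2 * Im X + Im Y) ^ 2 / cmod (line t X Y) ^ 2) = 0"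
    unfolding Im_ws sum_distrib_left mult_minus_right minus_add_distrib[symmetric] neg_equal_0_iff_equal
      sum.distrib[symmetric]
    by (rule trans[rotated], intro sum.cong)
       (auto simp: power2_eq_square algebra_simps add_divide_distrib)
  hence "\<forall>t\<in>{1..n}. real (u t) * (real t ^ 2 * Im X + Im Y) ^ 2 / cmod (line t X Y) ^ 2 = 0"
    by (subst (asm) sum_nonneg_eq_0_iff) auto
  hence z: "real t ^ 2 * Im X + Im Y = 0" if "t \<in> {1..n}" for t
    using that u off unfolding off_lines_def by fastforce
  show ?thesis using z[of 1] z[of 2] False n by auto
qed

text \<open>
  Up to a factor 4, this is the Jacobian determinant of \<open>(2 x A, 2 y B)\<close> in \<open>(x, y)\<close> at a critical
  point with \<open>X = x\<^sup>2\<close>, \<open>Y = y\<^sup>2\<close>. On an axis the off-diagonal product vanishes and the diagonal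
  entries are nonzero by the sign lemmas and the positivity of \<open>S\<close>. Off the axes \<open>A = B = 0\<close>,
  and the determinant is \<open>4 X Y (S 4 S 0 - (S 2)\<^sup>2)\<close>, which is positive by the strict Cauchy-Schwarz inequality.
\<close>

lemma simple_critical_det:
  fixes X Y :: real
  assumes n: "n \<ge> 1" and u: "\<forall>t\<in>{1..n}. 0 < u t" and off: "off_lines n X Y"
    and nonneg: "X \<ge> 0" "Y \<ge> 0"
    and A: "X = 0 \<or> weighted_sum n u 2 X Y = 0" and B: "Y = 0 \<or> weighted_sum n u 0 X Y = 0"
  defines "S \<equiv> \<lambda>k. (\<Sum>t\<in>{1..n}. real (u t) * real t ^ k / line t X Y ^ 2)"
  shows "(weighted_sum n u 2 X Y - 2 * X * S 4) * (weighted_sum n u 0 X Y - 2 * Y * S 0)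
     - (2 * X * S 2) * (2 * Y * S 2) \<noteq> 0"
proof -
  have Spos: "S k > 0" for k unfolding S_def
    using n u off by (intro sum_pos) (auto simp: off_lines_def)
  have Aneg: "weighted_sum n u 2 X Y < 0" if "X = 0"
    using weighted_sum_2_neg[OF n u off _ B] that by simp
  have Bneg: "weighted_sum n u 0 X Y < 0" if "Y = 0"
    using weighted_sum_0_neg[OF n u off _ A] that by simp
  consider "X = 0" "Y = 0" | "X = 0" "Y > 0" | "X > 0" "Y = 0" | "X > 0" "Y > 0"
    using nonneg by fastforce
  thus ?thesis
  proof cases
    case 1
    thus ?thesis using Aneg Bneg by simp
  next
    case 2
    thus ?thesis using Aneg B Spos[of 0] by simp
  next
    case 3
    thus ?thesis using Bneg A Spos[of 4] by simp
  next
    case 4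
    hence AB: "weighted_sum n u 2 X Y = 0" "weighted_sum n u 0 X Y = 0" using A B by auto
    have n2: "n \<ge> 2"
    proof (rule ccontr)
      assume "\<not> n \<ge> 2"
      hence "n = 1" using n by simp
      thus False using AB weighted_sum_one_nonzero[of u X Y 2] off u by auto
    qed
    \<comment> \<open>the weighted mean of the \<open>t\<^sup>2\<close>; their weighted variance is positive\<close>
    define c where "c = S 2 / S 0"
    have "c \<noteq> 1 \<or> c \<noteq> 4" by auto
    hence "\<exists>t\<in>{1..n}. real t ^ 2 \<noteq> c"
    proof
      assume "c \<noteq> 1" thus ?thesis using n2 by (intro bexI[of _ 1]) auto
    next
      assume "c \<noteq> 4" thus ?thesis using n2 by (intro bexI[of _ 2]) auto
    qed
    then obtain t where "t \<in> {1..n}" "real t ^ 2 \<noteq> c" by blast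
    hence "0 < (\<Sum>t\<in>{1..n}. real (u t) * (real t ^ 2 - c) ^ 2 / line t X Y ^ 2)"
      using u off by (intro sum_pos2[of _ t]) (auto simp: off_lines_def)
    also have "\<dots> = S 4 - 2 * c * S 2 + c ^ 2 * S 0"
      unfolding S_def sum_distrib_left sum_subtractf[symmetric] sum.distrib[symmetric]
      by (intro sum.cong) (auto simp: power2_diff diff_divide_distrib add_divide_distrib algebra_simps simp flip: power_mult power_add)
    also have "\<dots> = S 4 - S 2 ^ 2 / S 0"
      using Spos[of 0] by (simp add: c_def field_simps power2_eq_square)
    finally have "S 2 ^ 2 < S 4 * S 0" using Spos[of 0] by (simp add: field_simps)
    hence "4 * X * Y * (S 4 * S 0 - S 2 ^ 2) \<noteq> 0" using 4 by simp
    thus ?thesis by (simp add: AB power2_eq_square mult_ac)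
  qed
qed

section \<open>The ellipses\<close>

definition ellipse :: "nat \<Rightarrow> real poly2" where
  "ellipse t = [:[:- of_nat t, 0, of_nat t ^ 2:], 0, 1:]"

lemma eval2_ellipse: "eval2 (ellipse t) (x, y) = line t (x\<^sup>2) (y\<^sup>2)"
  by (simp add: eval2_def ellipse_def line_def power2_eq_square algebra_simps)

lemma complexify_ellipse: "complexify (ellipse t) = [:[:- of_nat t, 0, of_nat t ^ 2:], 0, 1:]"
  by (simp add: complexify_def ellipse_def map_poly_pCons)

lemma eval2_complexify_ellipse: "eval2 (complexify (ellipse t)) (x, y) = line t (x\<^sup>2) (y\<^sup>2)"
  by (simp add: eval2_def complexify_ellipse line_def power2_eq_square algebra_simps)

lemma partial1_ellipse: "partial1 (complexify (ellipse t)) = [:[:0, 2 * of_nat t ^ 2:]:]"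
  by (simp add: partial1_def complexify_ellipse map_poly_pCons pderiv_pCons)

lemma partial2_ellipse: "partial2 (complexify (ellipse t)) = [:0, 2:]"
  by (simp add: partial2_def complexify_ellipse pderiv_pCons)

lemma quadric_ellipse: "t \<ge> 1 \<Longrightarrow> quadric (ellipse t)"
proof -
  assume t: "t \<ge> 1"
  have "{i + j | i j. coeff (coeff (ellipse t) j) i \<noteq> 0} = {0, 2}" (is "?D = _")
  proof
    have *: "(i, j) \<in> {(0, 0), (2, 0), (0, 2)}" if "coeff (coeff (ellipse t) j) i \<noteq> 0" for i j
      using that by (auto simp: ellipse_def coeff_pCons split: nat.splits if_splits)
    show "?D \<subseteq> {0, 2}" using * by force
    have "coeff (coeff (ellipse t) 0) 0 \<noteq> 0" "coeff (coeff (ellipse t) 0) 2 \<noteq> 0"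
      using t by (simp_all add: ellipse_def coeff_pCons eval_nat_numeral)
    hence "0 + 0 \<in> ?D" "2 + 0 \<in> ?D" by blast+
    thus "{0, 2} \<subseteq> ?D" by simp
  qed
  thus ?thesis by (simp add: quadric_def total_degree_def)
qed

section \<open>Chambers of the lines in the closed quadrant\<close>

text \<open>
  Points on the coordinate axes are admitted: the copies of a chamber are glued along them when
  the quadrant is unfolded.
\<close>

definition chamber :: "nat \<Rightarrow> nat set \<Rightarrow> (real \<times> real) set" where
  "chamber n N = {(X, Y). 0 \<le> X \<and> 0 \<le> Y \<and>
     (\<forall>t\<in>{1..n}. if t \<in> N then line t X Y < 0 else line t X Y > 0)}"

lemma convex_chamber: "convex (chamber n N)"
proof -
  have eq: "(\<Inter>t\<in>{1..n}. {P. if t \<in> N then line t (fst P) (snd P) < 0 else line t (fst P) (snd P) > 0})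
      \<inter> {P. 0 \<le> fst P} \<inter> {P. 0 \<le> snd P} = chamber n N"
    by (auto simp: chamber_def)
  have cell: "convex {P. if t \<in> N then line t (fst P) (snd P) < 0 else line t (fst P) (snd P) > (0::real)}" for t
  proof -
    have l: "line t (fst P) (snd P) = (real t ^ 2, 1) \<bullet> P - real t" for P :: "real \<times> real"
      by (simp add: line_def inner_prod_def)
    show ?thesis unfolding l
      using convex_halfspace_lt[of "(real t ^ 2, 1)" "real t"] convex_halfspace_gt[of "real t" "(real t ^ 2, 1)"]
      by (cases "t \<in> N") (simp_all add: algebra_simps)
  qed
  have quadrant: "convex {P :: real \<times> real. 0 \<le> fst P}" "convex {P :: real \<times> real. 0 \<le> snd P}"
    using convex_halfspace_ge[of 0 "(1::real, 0::real)"] convex_halfspace_ge[of 0 "(0::real, 1::real)"]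
    by (simp_all add: inner_prod_def)
  show ?thesis unfolding eq[symmetric] by (intro convex_Int convex_INT cell quadrant)
qed

lemma chamber_off_lines: "(X, Y) \<in> chamber n N \<Longrightarrow> off_lines n X Y"
  unfolding chamber_def off_lines_def by (auto split: if_splits)

lemma chamber_same_indices:
  assumes "P \<in> chamber n N" "P \<in> chamber n M" "N \<subseteq> {1..n}" "M \<subseteq> {1..n}"
  shows "N = M"
proof -
  obtain X Y where P: "P = (X, Y)" by (cases P)
  have "t \<in> N \<longleftrightarrow> t \<in> M" if t: "t \<in> {1..n}" for t
  proof -
    have "if t \<in> N then line t X Y < 0 else line t X Y > 0" "if t \<in> M then line t X Y < 0 else line t X Y > 0"
      using assms(1,2) t unfolding P chamber_def by blast+
    thus ?thesis by (auto split: if_splits)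
  qed
  thus ?thesis using assms(3,4) by blast
qed

text \<open>
  On the axis \<open>X = 0\<close> the value \<open>L\<^sub>t = Y - t\<close> cannot turn positive again after being negative, and on the
  axis \<open>Y = 0\<close> the value \<open>L\<^sub>t = t (t X - 1)\<close> cannot be positive before being negative.
\<close>

lemma interval_chamber_pos:
  assumes "(X, Y) \<in> chamber n {j..k}" "1 \<le> j" "j \<le> k" "k \<le> n"
  shows "k < n \<Longrightarrow> 0 < X" "1 < j \<Longrightarrow> 0 < Y"
proof -
  have XY: "X \<ge> 0" "Y \<ge> 0" and s: "\<And>t. t \<in> {1..n} \<Longrightarrow> if t \<in> {j..k} then line t X Y < 0 else line t X Y > 0"
    using assms(1) by (auto simp: chamber_def)
  show "0 < X" if "k < n"
  proof (rule ccontr)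
    assume "\<not> 0 < X"
    hence "X = 0" using XY by simp
    thus False using s[of k] s[of n] that assms by (auto simp: line_def)
  qed
  show "0 < Y" if "1 < j"
  proof (rule ccontr)
    assume "\<not> 0 < Y"
    hence "Y = 0" using XY by simp
    hence "real j * (real j * X - 1) < 0" "X > 1"
      using s[of j] s[of 1] that assms by (auto simp: line_def algebra_simps power2_eq_square)
    hence "real j * X < 1" using that by (simp add: mult_less_0_iff)
    moreover have "1 * 1 \<le> real j * X" using that \<open>X > 1\<close> by (intro mult_mono) auto
    ultimately show False by simp
  qed
qed

lemma line_factored:
  fixes \<alpha> \<beta> :: real
  assumes "\<alpha> + \<beta> \<noteq> 0"
  shows "line t (1 / (\<alpha> + \<beta>)) (\<alpha> * \<beta> / (\<alpha> + \<beta>)) = (real t - \<alpha>) * (real t - \<beta>) / (\<alpha> + \<beta>)"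
proof -
  have "(real t - \<alpha>) * (real t - \<beta>) = real t ^ 2 + \<alpha> * \<beta> - real t * (\<alpha> + \<beta>)"
    by (simp add: algebra_simps power2_eq_square)
  thus ?thesis using assms by (simp add: line_def add_divide_distrib diff_divide_distrib)
qed

text \<open>
  The witness is the point at which the quadratic \<open>t \<mapsto> L\<^sub>t\<close> has the roots \<open>j - 1/2\<close> and \<open>k + 1/2\<close>.
\<close>

lemma interval_chamber_nonempty:
  assumes "1 \<le> j" "j \<le> k"
  shows "(1 / real (j + k), (real j - 1/2) * (real k + 1/2) / real (j + k)) \<in> chamber n {j..k}"
proof -
  define \<alpha> \<beta> where "\<alpha> = real j - 1/2" and "\<beta> = real k + 1/2"
  have ab: "\<alpha> + \<beta> = real (j + k)" "\<alpha> > 0" "\<beta> > 0" using assms by (auto simp: \<alpha>_def \<beta>_def)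
  have "if t \<in> {j..k} then line t (1 / (\<alpha> + \<beta>)) (\<alpha> * \<beta> / (\<alpha> + \<beta>)) < 0
        else line t (1 / (\<alpha> + \<beta>)) (\<alpha> * \<beta> / (\<alpha> + \<beta>)) > 0" for t
  proof -
    consider "t < j" | "t \<in> {j..k}" | "t > k" by fastforce
    thus ?thesis
    proof cases
      case 1
      hence "real t + 1 \<le> real j" by linarith
      hence "real t - \<alpha> < 0" "real t - \<beta> < 0" using assms by (auto simp: \<alpha>_def \<beta>_def)
      thus ?thesis using 1 ab by (subst (1 2) line_factored) (auto simp: divide_less_0_iff zero_less_divide_iff mult_neg_neg)
    next
      case 2
      hence "real t - \<alpha> > 0" "real t - \<beta> < 0" using assms by (auto simp: \<alpha>_def \<beta>_def)
      thus ?thesis using 2 ab by (subst (1 2) line_factored) (auto simp: divide_less_0_iff zero_less_divide_iff mult_pos_neg)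
    next
      case 3
      hence "real k + 1 \<le> real t" by linarith
      hence "real t - \<alpha> > 0" "real t - \<beta> > 0" using assms by (auto simp: \<alpha>_def \<beta>_def)
      thus ?thesis using 3 ab by (subst (1 2) line_factored) (auto simp: divide_less_0_iff zero_less_divide_iff)
    qed
  qed
  note sign = this[unfolded ab(1), unfolded \<alpha>_def \<beta>_def]
  show ?thesis unfolding chamber_def using sign assms by (simp del: of_nat_add)
qed

text \<open>
  On the axes \<open>L\<^sub>t\<close> has a single positive root in \<open>t\<close>, which is placed at \<open>j - 1/2\<close> or \<open>k + 1/2\<close>.
\<close>

lemma interval_chamber_meets_axes:
  assumes "1 \<le> j" "j \<le> k"
  shows "k = n \<Longrightarrow> \<exists>Y. (0, Y) \<in> chamber n {j..k}" "j = 1 \<Longrightarrow> \<exists>X. (X, 0) \<in> chamber n {j..k}"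
proof -
  show "\<exists>Y. (0, Y) \<in> chamber n {j..k}" if "k = n"
    using assms that by (intro exI[of _ "real j - 1/2"]) (auto simp: chamber_def line_def)
  show "\<exists>X. (X, 0) \<in> chamber n {j..k}" if "j = 1"
  proof (intro exI[of _ "1 / (real k + 1/2)"])
    have "line t (1 / (real k + 1/2)) 0 = real t * (real t - (real k + 1/2)) / (real k + 1/2)" for t
      by (simp add: line_def field_simps power2_eq_square)
    thus "(1 / (real k + 1/2), 0) \<in> chamber n {j..k}"
      using that by (auto simp: chamber_def divide_less_0_iff zero_less_divide_iff mult_less_0_iff zero_less_mult_iff)
  qed
qed

lemma outer_chamber_meets_axes: "(0, real n + 1) \<in> chamber n {}" "(2, 0) \<in> chamber n {}"
proof -
  have "real t < 2 * real t ^ 2" if "1 \<le> t" for t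
  proof -
    have "real t * 1 \<le> real t * real t" using that by (intro mult_left_mono) auto
    thus ?thesis using that by (simp add: power2_eq_square)
  qed
  thus "(2, 0) \<in> chamber n {}" by (auto simp: chamber_def line_def mult.commute)
qed (auto simp: chamber_def line_def)

section \<open>Unfolding the quadrant\<close>

text \<open>
  One copy of \<open>E\<close> is its image under \<open>(\<surd>X, y)\<close>, the other under \<open>(-\<surd>X, y)\<close>. If \<open>E\<close> reaches the axis,
  both are taken and they share a point (\<open>p = 0\<close>); otherwise the sign of \<open>p\<close> selects one of them.
\<close>

lemma connected_unfold_fst:
  fixes E :: "(real \<times> real) set" and p :: int
  assumes E: "connected E" and nonneg: "\<And>z. z \<in> E \<Longrightarrow> 0 \<le> fst z"
    and axis: "if p = 0 then \<exists>y. (0, y) \<in> E else (\<forall>z\<in>E. 0 < fst z)"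
  shows "connected {(x, y). (x\<^sup>2, y) \<in> E \<and> (p \<noteq> 0 \<longrightarrow> 0 < of_int p * x)}"
proof -
  have conn: "connected ((\<lambda>z. (s * sqrt (fst z), snd z)) ` E)" for s :: real
    by (intro connected_continuous_image E continuous_intros)
  have img: "(\<lambda>z. (s * sqrt (fst z), snd z)) ` E = {(x, y). (x\<^sup>2, y) \<in> E \<and> 0 \<le> s * x}"
    if s: "s = 1 \<or> s = - 1" for s :: real
  proof (intro set_eqI iffI)
    fix w assume "w \<in> (\<lambda>z. (s * sqrt (fst z), snd z)) ` E"
    thus "w \<in> {(x, y). (x\<^sup>2, y) \<in> E \<and> 0 \<le> s * x}"
      using nonneg s by (auto simp: power_mult_distrib)
  next
    fix w assume "w \<in> {(x, y). (x\<^sup>2, y) \<in> E \<and> 0 \<le> s * x}"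
    thus "w \<in> (\<lambda>z. (s * sqrt (fst z), snd z)) ` E"
      using s by (intro image_eqI[of _ _ "((fst w)\<^sup>2, snd w)"]) (auto simp: real_sqrt_abs)
  qed
  show ?thesis
  proof (cases "p = 0")
    case True
    then obtain y where y: "(0, y) \<in> E" using axis by auto
    have "{(x, y). (x\<^sup>2, y) \<in> E \<and> (p \<noteq> 0 \<longrightarrow> 0 < of_int p * x)} =
        {(x, y). (x\<^sup>2, y) \<in> E \<and> 0 \<le> 1 * x} \<union> {(x, y). (x\<^sup>2, y) \<in> E \<and> 0 \<le> (- 1) * x}"
      using True by auto
    moreover have "connected {(x, y). (x\<^sup>2, y) \<in> E \<and> 0 \<le> s * x}" if "s = 1 \<or> s = - 1" for s
      using conn[of s] img[OF that] by simp
    moreover have "(0, y) \<in> {(x, y). (x\<^sup>2, y) \<in> E \<and> 0 \<le> 1 * x} \<inter> {(x, y). (x\<^sup>2, y) \<in> E \<and> 0 \<le> (- 1) * x}"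
      using y by simp
    ultimately show ?thesis by (metis (no_types, lifting) connected_Un empty_iff)
  next
    case False
    define s :: real where "s = sgn (of_int p)"
    have s: "s = 1 \<or> s = - 1" using False by (auto simp: s_def sgn_if)
    have "{(x, y). (x\<^sup>2, y) \<in> E \<and> (p \<noteq> 0 \<longrightarrow> 0 < of_int p * x)} = {(x, y). (x\<^sup>2, y) \<in> E \<and> 0 \<le> s * x}"
    proof -
      have nz: "x \<noteq> 0" if "(x\<^sup>2, y) \<in> E" for x y using axis False that by fastforce
      have "(0 < of_int p * x) = (0 \<le> s * x)" if "(x\<^sup>2, y) \<in> E" for x y
      proof (cases "p > 0")
        case True
        thus ?thesis using nz[OF that] by (auto simp: s_def zero_less_mult_iff zero_le_mult_iff)
      next
        case False
        thus ?thesis using nz[OF that] \<open>p \<noteq> 0\<close> by (auto simp: s_def zero_less_mult_iff zero_le_mult_iff)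
      qed
      thus ?thesis using False by auto
    qed
    thus ?thesis using conn[of s] img[OF s] by simp
  qed
qed

lemma connected_swap: "connected E \<Longrightarrow> connected {(x, y). (y, x) \<in> (E :: (real \<times> real) set)}"
proof -
  assume "connected E"
  hence "connected (prod.swap ` E)" unfolding prod.swap_def
    by (intro connected_continuous_image continuous_intros)
  moreover have "prod.swap ` E = {(x, y). (y, x) \<in> E}" by force
  ultimately show ?thesis by simp
qed

lemma connected_unfold:
  fixes C :: "(real \<times> real) set" and p q :: int
  assumes C: "connected C" and nonneg: "\<And>X Y. (X, Y) \<in> C \<Longrightarrow> 0 \<le> X \<and> 0 \<le> Y"
    and p: "if p = 0 then \<exists>Y. (0, Y) \<in> C else (\<forall>(X, Y)\<in>C. 0 < X)"
    and q: "if q = 0 then \<exists>X. (X, 0) \<in> C else (\<forall>(X, Y)\<in>C. 0 < Y)"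
  shows "connected {(x, y). (x\<^sup>2, y\<^sup>2) \<in> C \<and> (p \<noteq> 0 \<longrightarrow> 0 < of_int p * x) \<and> (q \<noteq> 0 \<longrightarrow> 0 < of_int q * y)}"
proof -
  define E where "E = {(x, Y). (x\<^sup>2, Y) \<in> C \<and> (p \<noteq> 0 \<longrightarrow> 0 < real_of_int p * x)}"
  have "connected E" unfolding E_def
    using p nonneg by (intro connected_unfold_fst C) (auto split: if_splits)
  hence "connected {(Y, x). (x, Y) \<in> E}" by (rule connected_swap)
  moreover have "if q = 0 then \<exists>x. (0, x) \<in> {(Y, x). (x, Y) \<in> E} else (\<forall>z\<in>{(Y, x). (x, Y) \<in> E}. 0 < fst z)"
  proof (cases "q = 0")
    case True
    then obtain X where X: "(X, 0) \<in> C" using q by auto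
    define x where "x = (if p < 0 then - sqrt X else sqrt X)"
    have "x\<^sup>2 = X" using nonneg[OF X] by (simp add: x_def)
    moreover have "0 < real_of_int p * x" if "p \<noteq> 0"
      using p that X by (auto simp: x_def zero_less_mult_iff)
    ultimately show ?thesis using X True unfolding E_def by auto
  next
    case False
    thus ?thesis using q unfolding E_def by auto
  qed
  ultimately have "connected {(y, x). (y\<^sup>2, x) \<in> {(Y, x). (x, Y) \<in> E} \<and> (q \<noteq> 0 \<longrightarrow> 0 < real_of_int q * y)}"
    using nonneg by (intro connected_unfold_fst) (auto simp: E_def)
  from connected_swap[OF this] show ?thesis
    by (rule back_subst[where P = connected]) (auto simp: E_def)
qed

section \<open>The regions of the ellipses\<close>

text \<open>
  The index set of the bounded regions. The entry \<open>p\<close> carries the sign of \<open>x\<close> and the number \<open>n - k\<close> of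
  lines after the interval of negative indices, \<open>q\<close> the sign of \<open>y\<close> and the number \<open>j - 1\<close> of lines before
  it. An entry is zero precisely if the region crosses the corresponding axis, so that no sign is to
  be recorded.
\<close>

definition diamond :: "nat \<Rightarrow> (int \<times> int) set" where
  "diamond n = {(p, q). \<bar>p\<bar> + \<bar>q\<bar> < int n}"

lemma finite_diamond: "finite (diamond n)"
  by (rule finite_subset[of _ "{- int n..int n} \<times> {- int n..int n}"]) (auto simp: diamond_def)

lemma card_diamond:
  assumes "n \<ge> 1" shows "card (diamond n) = 2 * n ^ 2 - 2 * n + 1"
proof -
  define m where "m = n - 1"
  have n: "n = Suc m" using assms by (simp add: m_def)
  have D: "diamond n = (SIGMA p:{- int m..int m}. {- (int m - \<bar>p\<bar>)..int m - \<bar>p\<bar>})"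
    by (auto simp: diamond_def n)
  \<comment> \<open>for the induction, the bound of the summation is separated from the size of the diamond\<close>
  have "(\<Sum>p\<in>{- int k..int k}. 2 * int m + 1 - 2 * \<bar>p\<bar>) = (2 * int k + 1) * (2 * int m + 1) - 2 * int k * (int k + 1)" for k
  proof (induction k)
    case (Suc k)
    have "{- int (Suc k)..int (Suc k)} = insert (- int (Suc k)) (insert (int (Suc k)) {- int k..int k})"
      by auto
    thus ?case using Suc by (simp add: algebra_simps)
  qed simp
  from this[of m] have "(\<Sum>p\<in>{- int m..int m}. 2 * int m + 1 - 2 * \<bar>p\<bar>) = 2 * int m ^ 2 + 2 * int m + 1"
    by (simp add: algebra_simps power2_eq_square)
  moreover have "int (card (diamond n)) = (\<Sum>p\<in>{- int m..int m}. 2 * int m + 1 - 2 * \<bar>p\<bar>)"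
    unfolding D by (subst card_SigmaI) (auto intro!: sum.cong)
  ultimately have "int (card (diamond n)) = int (2 * m ^ 2 + 2 * m + 1)" by simp
  hence "card (diamond n) = 2 * m ^ 2 + 2 * m + 1" by (simp only: of_nat_eq_iff)
  thus ?thesis by (simp add: n power2_eq_square)
qed

text \<open>
  Each component meets only one member of such a partition, since that member and the union of the
  others are open.
\<close>

lemma components_eqI:
  fixes \<D> :: "'a::topological_space set set"
  assumes un: "\<Union>\<D> = S" and op: "\<And>D. D \<in> \<D> \<Longrightarrow> open D"
    and conn: "\<And>D. D \<in> \<D> \<Longrightarrow> connected D" and ne: "\<And>D. D \<in> \<D> \<Longrightarrow> D \<noteq> {}"
    and disj: "\<And>D D'. D \<in> \<D> \<Longrightarrow> D' \<in> \<D> \<Longrightarrow> D \<noteq> D' \<Longrightarrow> D \<inter> D' = {}"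
  shows "components S = \<D>"
proof -
  have D: "connected_component_set S x = D" if x: "x \<in> D" and D: "D \<in> \<D>" for x D
  proof
    show "D \<subseteq> connected_component_set S x"
      using x D un conn[OF D] by (intro connected_component_maximal) auto
    show "connected_component_set S x \<subseteq> D"
    proof (rule ccontr)
      assume n: "\<not> ?thesis"
      have sub: "connected_component_set S x \<subseteq> D \<union> \<Union>(\<D> - {D})"
        using connected_component_subset[of S x] un by auto
      have "x \<in> S" using x D un by auto
      hence "D \<inter> connected_component_set S x \<noteq> {}" using x by (auto simp: connected_component_refl_eq)
      moreover have "\<Union>(\<D> - {D}) \<inter> connected_component_set S x \<noteq> {}" using n sub by blast
      moreover have "D \<inter> \<Union>(\<D> - {D}) \<inter> connected_component_set S x = {}" using disj[OF D] by blast
      moreover have "open (\<Union>(\<D> - {D}))" by (rule open_Union) (use op in simp)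
      ultimately show False
        using connectedD[OF connected_connected_component[of S x] op[OF D] _ _ sub] by simp
    qed
  qed
  show ?thesis
  proof
    show "components S \<subseteq> \<D>"
    proof
      fix C assume "C \<in> components S"
      then obtain x where x: "x \<in> S" "C = connected_component_set S x" unfolding components_def by blast
      then obtain D' where "x \<in> D'" "D' \<in> \<D>" using un by blast
      thus "C \<in> \<D>" using D x(2) by simp
    qed
    show "\<D> \<subseteq> components S"
    proof
      fix D' assume D': "D' \<in> \<D>"
      then obtain x where x: "x \<in> D'" using ne by blast
      hence "x \<in> S" using un D' by blast
      thus "D' \<in> components S" unfolding components_def using D[OF x D'] by (metis imageI)
    qed
  qed
qed

definition negative_indices :: "nat \<Rightarrow> int \<times> int \<Rightarrow> nat set" where
  "negative_indices n = (\<lambda>(p, q). {nat \<bar>q\<bar> + 1..n - nat \<bar>p\<bar>})"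

definition region :: "nat \<Rightarrow> int \<times> int \<Rightarrow> (real \<times> real) set" where
  "region n = (\<lambda>(p, q). {(x, y). (x\<^sup>2, y\<^sup>2) \<in> chamber n (negative_indices n (p, q)) \<and>
     (p \<noteq> 0 \<longrightarrow> 0 < of_int p * x) \<and> (q \<noteq> 0 \<longrightarrow> 0 < of_int q * y)})"

definition outer_region :: "nat \<Rightarrow> (real \<times> real) set" where
  "outer_region n = {(x, y). (x\<^sup>2, y\<^sup>2) \<in> chamber n {}}"

lemma diamond_interval:
  assumes "(p, q) \<in> diamond n"
  obtains j k where "negative_indices n (p, q) = {j..k}" "1 \<le> j" "j \<le> k" "k \<le> n"
    "\<bar>p\<bar> = int (n - k)" "\<bar>q\<bar> = int (j - 1)"
proof
  show "negative_indices n (p, q) = {nat \<bar>q\<bar> + 1..n - nat \<bar>p\<bar>}" by (simp add: negative_indices_def)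
qed (use assms in \<open>auto simp: diamond_def\<close>)

lemma connected_region: "i \<in> diamond n \<Longrightarrow> connected (region n i)"
proof -
  assume "i \<in> diamond n"
  then obtain p q where i: "i = (p, q)" "(p, q) \<in> diamond n" by (cases i) auto
  from diamond_interval[OF i(2)] obtain j k where
    D: "negative_indices n (p, q) = {j..k}" "1 \<le> j" "j \<le> k" "k \<le> n"
    and pq: "\<bar>p\<bar> = int (n - k)" "\<bar>q\<bar> = int (j - 1)" .
  have p0: "p = 0 \<longleftrightarrow> k = n" and q0: "q = 0 \<longleftrightarrow> j = 1" using pq D(2-4) by auto
  show ?thesis unfolding i(1) region_def prod.case
  proof (rule connected_unfold)
    show "connected (chamber n (negative_indices n (p, q)))"
      using convex_chamber by (rule convex_connected)
    show "if p = 0 then \<exists>Y. (0, Y) \<in> chamber n (negative_indices n (p, q))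
        else \<forall>(X, Y)\<in>chamber n (negative_indices n (p, q)). 0 < X"
      using interval_chamber_pos(1)[OF _ D(2-4)] interval_chamber_meets_axes(1)[OF D(2,3), of n] D(4)
      unfolding D(1) p0 by auto
    show "if q = 0 then \<exists>X. (X, 0) \<in> chamber n (negative_indices n (p, q))
        else \<forall>(X, Y)\<in>chamber n (negative_indices n (p, q)). 0 < Y"
      using interval_chamber_pos(2)[OF _ D(2-4)] interval_chamber_meets_axes(2)[OF D(2,3), of n] D(2)
      unfolding D(1) q0 by auto
  qed (auto simp: chamber_def)
qed

lemma connected_outer_region: "connected (outer_region n)"
proof -
  have "connected {(x, y). (x\<^sup>2, y\<^sup>2) \<in> chamber n {} \<and> ((0::int) \<noteq> 0 \<longrightarrow> 0 < of_int 0 * x)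
      \<and> ((0::int) \<noteq> 0 \<longrightarrow> 0 < of_int 0 * y)}"
  proof (rule connected_unfold)
    show "connected (chamber n {})" using convex_chamber by (rule convex_connected)
    show "if (0::int) = 0 then \<exists>Y. (0, Y) \<in> chamber n {} else \<forall>(X, Y)\<in>chamber n {}. 0 < X"
      "if (0::int) = 0 then \<exists>X. (X, 0) \<in> chamber n {} else \<forall>(X, Y)\<in>chamber n {}. 0 < Y"
      unfolding if_P[OF refl] using outer_chamber_meets_axes by blast+
  qed (simp_all add: chamber_def)
  thus ?thesis by (simp add: outer_region_def)
qed

lemma region_nonempty: "i \<in> diamond n \<Longrightarrow> region n i \<noteq> {}"
proof -
  assume "i \<in> diamond n"
  then obtain p q where i: "i = (p, q)" "(p, q) \<in> diamond n" by (cases i) auto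
  from diamond_interval[OF i(2)] obtain j k where
    D: "negative_indices n (p, q) = {j..k}" "1 \<le> j" "j \<le> k" .
  define X Y where "X = 1 / real (j + k)" and "Y = (real j - 1/2) * (real k + 1/2) / real (j + k)"
  have C: "(X, Y) \<in> chamber n (negative_indices n (p, q))" and XY: "X > 0" "Y > 0"
    using interval_chamber_nonempty[OF D(2,3)] D by (auto simp: X_def Y_def)
  have "(if p < 0 then - sqrt X else sqrt X, if q < 0 then - sqrt Y else sqrt Y) \<in> region n i"
    using C XY unfolding i(1) region_def by (auto simp: zero_less_mult_iff)
  thus ?thesis by blast
qed

lemma open_sign_cell: "open {(x :: real, y :: real). (x\<^sup>2, y\<^sup>2) \<in> chamber n N}"
proof -
  have "open {z. if t \<in> N then line t ((fst z)\<^sup>2) ((snd z)\<^sup>2) < 0 else line t ((fst z)\<^sup>2) ((snd z)\<^sup>2) > (0::real)}" for t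
    unfolding line_def
    by (cases "t \<in> N"; simp; intro open_Collect_less continuous_intros)
  hence "open (\<Inter>t\<in>{1..n}. {z. if t \<in> N then line t ((fst z)\<^sup>2) ((snd z)\<^sup>2) < 0 else line t ((fst z)\<^sup>2) ((snd z)\<^sup>2) > (0::real)})"
    by (intro open_INT) auto
  also have "\<dots> = {(x, y). (x\<^sup>2, y\<^sup>2) \<in> chamber n N}" by (auto simp: chamber_def)
  finally show ?thesis .
qed

lemma open_region: "open (region n i)"
proof (cases i)
  case (Pair p q)
  have "region n i = {(x :: real, y :: real). (x\<^sup>2, y\<^sup>2) \<in> chamber n (negative_indices n i)}
      \<inter> {z. p \<noteq> 0 \<longrightarrow> 0 < of_int p * fst z} \<inter> {z. q \<noteq> 0 \<longrightarrow> 0 < of_int q * snd z}"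
    unfolding region_def Pair by auto
  moreover have "open {z :: real \<times> real. p \<noteq> 0 \<longrightarrow> 0 < of_int p * fst z}"
    by (cases "p = 0"; simp; intro open_Collect_less continuous_intros)
  moreover have "open {z :: real \<times> real. q \<noteq> 0 \<longrightarrow> 0 < of_int q * snd z}"
    by (cases "q = 0"; simp; intro open_Collect_less continuous_intros)
  ultimately show ?thesis using open_sign_cell[of n "negative_indices n i"] by (simp only: open_Int)
qed

lemma open_outer_region: "open (outer_region n)"
  unfolding outer_region_def by (rule open_sign_cell)

lemma region_disjoint:
  assumes "i \<in> diamond n" "i' \<in> diamond n" "z \<in> region n i" "z \<in> region n i'"
  shows "i = i'"
proof -
  obtain p q where i1: "i = (p, q)" by (cases i)
  obtain p' q' where i2: "i' = (p', q')" by (cases i')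
  note i = i1 i2
  obtain x y where z: "z = (x, y)" by (cases z)
  from diamond_interval[OF assms(1)[unfolded i]] obtain j k where
    D: "negative_indices n (p, q) = {j..k}" "1 \<le> j" "j \<le> k" "k \<le> n"
    "\<bar>p\<bar> = int (n - k)" "\<bar>q\<bar> = int (j - 1)" .
  from diamond_interval[OF assms(2)[unfolded i]] obtain j' k' where
    D': "negative_indices n (p', q') = {j'..k'}" "1 \<le> j'" "j' \<le> k'" "k' \<le> n"
    "\<bar>p'\<bar> = int (n - k')" "\<bar>q'\<bar> = int (j' - 1)" .
  have mem: "(x\<^sup>2, y\<^sup>2) \<in> chamber n (negative_indices n (p, q))" "(x\<^sup>2, y\<^sup>2) \<in> chamber n (negative_indices n (p', q'))"
    and sg: "p \<noteq> 0 \<longrightarrow> 0 < of_int p * x" "q \<noteq> 0 \<longrightarrow> 0 < of_int q * y"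
      "p' \<noteq> 0 \<longrightarrow> 0 < of_int p' * x" "q' \<noteq> 0 \<longrightarrow> 0 < of_int q' * y"
    using assms(3,4) unfolding i z region_def by auto
  have "{j..k} = {j'..k'}"
    using D(2-4) D'(2-4) by (intro chamber_same_indices[OF mem[unfolded D(1) D'(1)]]) auto
  hence "j = j' \<and> k = k'" unfolding Icc_eq_Icc using D(3) D'(3) by simp
  hence "\<bar>p\<bar> = \<bar>p'\<bar>" "\<bar>q\<bar> = \<bar>q'\<bar>" using D(5,6) D'(5,6) by simp_all
  hence "p = p' \<or> p = - p'" "q = q' \<or> q = - q'" by (simp_all add: abs_eq_iff)
  moreover have "p = p'" if "p = - p'" using sg(1,3) that by (cases "p = 0") simp_all
  moreover have "q = q'" if "q = - q'" using sg(2,4) that by (cases "q = 0") simp_all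
  ultimately have "p = p'" "q = q'" by blast+
  thus ?thesis by (simp add: i)
qed

lemma outer_region_disjoint: "i \<in> diamond n \<Longrightarrow> region n i \<inter> outer_region n = {}"
proof (rule ccontr)
  assume i: "i \<in> diamond n" and "region n i \<inter> outer_region n \<noteq> {}"
  then obtain x y where z: "(x, y) \<in> region n i" "(x, y) \<in> outer_region n" by auto
  obtain p q where pq: "i = (p, q)" by (cases i)
  from diamond_interval[OF i[unfolded pq]] obtain j k where
    D: "negative_indices n (p, q) = {j..k}" "1 \<le> j" "j \<le> k" "k \<le> n" .
  have "{j..k} = {}"
    using z D by (intro chamber_same_indices[of "(x\<^sup>2, y\<^sup>2)" n]) (auto simp: region_def outer_region_def pq)
  thus False using D(3) by simp
qed

text \<open>
  Convexity of \<open>t \<mapsto> L\<^sub>t\<close>, which makes the set of negative indices an interval.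
\<close>

lemma line_between_neg:
  fixes X Y :: real
  assumes "X \<ge> 0" "line a X Y < 0" "line b X Y < 0" "a \<le> t" "t \<le> b"
  shows "line t X Y < 0"
proof (cases "a = b")
  case False
  hence ab: "real a < real b" using assms by simp
  have "(real b - real a) * line t X Y = (real b - real t) * line a X Y + (real t - real a) * line b X Y
      - X * (real t - real a) * (real b - real t) * (real b - real a)"
    by (simp add: line_def algebra_simps power2_eq_square)
  moreover have "(real b - real t) * line a X Y + (real t - real a) * line b X Y < 0"
  proof (cases "t = a")
    case True
    thus ?thesis using ab assms by (simp add: mult_pos_neg)
  next
    case False
    hence "(real t - real a) * line b X Y < 0" using assms by (intro mult_pos_neg) auto
    moreover have "(real b - real t) * line a X Y \<le> 0" using assms by (intro mult_nonneg_nonpos) auto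
    ultimately show ?thesis by simp
  qed
  moreover have "X * (real t - real a) * (real b - real t) * (real b - real a) \<ge> 0"
    using assms by (intro mult_nonneg_nonneg) auto
  ultimately have "(real b - real a) * line t X Y < 0" by linarith
  thus ?thesis using ab by (simp add: mult_less_0_iff)
qed (use assms in auto)

text \<open>
  The least and the greatest negative index determine the interval, and the signs of \<open>x\<close> and \<open>y\<close> the
  mirror image. Where a sign has to be recorded, the coordinate is nonzero by \<open>interval_chamber_pos\<close>.
\<close>

lemma off_lines_region:
  fixes x y :: real
  assumes off: "off_lines n (x\<^sup>2) (y\<^sup>2)"
  shows "(x, y) \<in> outer_region n \<or> (\<exists>i\<in>diamond n. (x, y) \<in> region n i)"
proof -
  define N where "N = {t \<in> {1..n}. line t (x\<^sup>2) (y\<^sup>2) < 0}"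
  have C: "(x\<^sup>2, y\<^sup>2) \<in> chamber n N"
    using off unfolding chamber_def N_def off_lines_def by force
  show ?thesis
  proof (cases "N = {}")
    case True
    thus ?thesis using C unfolding outer_region_def by auto
  next
    case False
    have fin: "finite N" by (simp add: N_def)
    define j k where "j = Min N" and "k = Max N"
    have jk: "j \<in> N" "k \<in> N" using fin False by (auto simp: j_def k_def)
    hence jk': "1 \<le> j" "j \<le> k" "k \<le> n" using fin by (auto simp: N_def j_def)
    have N: "N = {j..k}"
    proof
      show "N \<subseteq> {j..k}" using fin by (auto simp: j_def k_def)
      show "{j..k} \<subseteq> N"
        using line_between_neg[of "x\<^sup>2" j "y\<^sup>2" k] jk jk' unfolding N_def by auto
    qed
    note pos = interval_chamber_pos[OF C[unfolded N] jk']
    define p q where "p = (if x < 0 then - int (n - k) else int (n - k))"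
      and "q = (if y < 0 then - int (j - 1) else int (j - 1))"
    have "(p, q) \<in> diamond n" using jk' by (auto simp: diamond_def p_def q_def)
    moreover have "negative_indices n (p, q) = N"
      using jk' unfolding N by (auto simp: negative_indices_def p_def q_def)
    moreover have "p \<noteq> 0 \<longrightarrow> 0 < of_int p * x" "q \<noteq> 0 \<longrightarrow> 0 < of_int q * y"
      using pos by (auto simp: p_def q_def zero_less_mult_iff)
    ultimately have "(x, y) \<in> region n (p, q)" using C unfolding region_def by auto
    thus ?thesis using \<open>(p, q) \<in> diamond n\<close> by blast
  qed
qed

lemma region_off_lines: "(x, y) \<in> region n i \<Longrightarrow> off_lines n (x\<^sup>2) (y\<^sup>2)"
  unfolding region_def by (auto split: prod.splits intro: chamber_off_lines)

lemma V_real_ellipse: "V_real n ellipse = {(x, y). off_lines n (x\<^sup>2) (y\<^sup>2)}"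
  unfolding V_real_def off_lines_def by (auto simp: eval2_ellipse)

lemma components_ellipses: "components (V_real n ellipse) = insert (outer_region n) (region n ` diamond n)"
proof (rule components_eqI)
  show "\<Union> (insert (outer_region n) (region n ` diamond n)) = V_real n ellipse"
    (is "?U = _")
  proof
    show "?U \<subseteq> V_real n ellipse"
      using region_off_lines chamber_off_lines unfolding V_real_ellipse by (auto simp: outer_region_def)
    show "V_real n ellipse \<subseteq> ?U"
      using off_lines_region[of n] unfolding V_real_ellipse by blast
  qed
  have "(0, sqrt (real n + 1)) \<in> outer_region n"
    using outer_chamber_meets_axes(1)[of n] by (simp add: outer_region_def)
  hence "outer_region n \<noteq> {}" by blast
  thus "D \<noteq> {}" if "D \<in> insert (outer_region n) (region n ` diamond n)" for D
    using that region_nonempty by auto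
  show "D \<inter> D' = {}" if "D \<in> insert (outer_region n) (region n ` diamond n)"
    "D' \<in> insert (outer_region n) (region n ` diamond n)" "D \<noteq> D'" for D D'
  proof -
    have rr: "region n i \<inter> region n i' = {}"
      if "i \<in> diamond n" "i' \<in> diamond n" "region n i \<noteq> region n i'" for i i'
      using region_disjoint[OF that(1,2)] that(3) by blast
    show ?thesis using that
      by (elim insertE imageE) (simp_all add: rr outer_region_disjoint Int_commute[of "outer_region n"])
  qed
qed (auto intro: open_region open_outer_region connected_region connected_outer_region)

lemma bounded_region: 
  assumes "i \<in> diamond n" shows "bounded (region n i)"
proof -
  obtain p q where pq: "i = (p, q)" by (cases i)
  from diamond_interval[OF assms[unfolded pq]] obtain j k where
    D: "negative_indices n (p, q) = {j..k}" "1 \<le> j" "j \<le> k" "k \<le> n" .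
  have "region n i \<subseteq> {- real j..real j} \<times> {- real j..real j}"
  proof
    fix z assume z: "z \<in> region n i"
    obtain x y where xy: "z = (x, y)" by (cases z)
    have "line j (x\<^sup>2) (y\<^sup>2) < 0" using z D unfolding xy pq region_def chamber_def by force
    hence le: "real j ^ 2 * x\<^sup>2 + y\<^sup>2 < real j" by (simp add: line_def)
    have j1: "1 \<le> real j" using D by simp
    have "real j \<le> real j ^ 2" using j1 by (simp add: power2_eq_square)
    moreover have "1 * x\<^sup>2 \<le> real j ^ 2 * x\<^sup>2" using j1 by (intro mult_right_mono) (auto simp: one_le_power)
    ultimately have "x\<^sup>2 \<le> real j ^ 2" "y\<^sup>2 \<le> real j ^ 2"
      using le zero_le_power2[of x] zero_le_power2[of y] by linarith+
    thus "z \<in> {- real j..real j} \<times> {- real j..real j}"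
      unfolding xy by (auto simp: abs_le_square_iff[symmetric])
  qed
  moreover have "bounded ({- real j..real j} \<times> {- real j..real j})" by (intro bounded_Times) auto
  ultimately show ?thesis using bounded_subset by blast
qed

lemma unbounded_outer_region: "\<not> bounded (outer_region n)"
proof
  assume "bounded (outer_region n)"
  then obtain B where B: "\<And>z. z \<in> outer_region n \<Longrightarrow> norm z \<le> B" by (auto simp: bounded_iff)
  define y where "y = real n + \<bar>B\<bar> + 1"
  have "y * 1 \<le> y * y" by (intro mult_left_mono) (auto simp: y_def)
  hence "real n < y\<^sup>2" by (simp add: y_def power2_eq_square)
  hence "(0, y) \<in> outer_region n" by (auto simp: outer_region_def chamber_def line_def)
  from B[OF this] show False by (simp add: norm_Pair y_def)
qed

lemma card_bounded_regions:
  assumes "n \<ge> 1"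
  shows "card (bounded_regions n ellipse) = 2 * n ^ 2 - 2 * n + 1"
proof -
  have "bounded_regions n ellipse = region n ` diamond n"
    unfolding bounded_regions_def components_ellipses
    using bounded_region unbounded_outer_region by auto
  moreover have "inj_on (region n) (diamond n)"
  proof (rule inj_onI)
    fix i i' assume i: "i \<in> diamond n" "i' \<in> diamond n" "region n i = region n i'"
    then obtain z where "z \<in> region n i" using region_nonempty by blast
    thus "i = i'" using region_disjoint[OF i(1,2)] i(3) by blast
  qed
  ultimately show ?thesis using card_diamond[OF assms] by (simp add: card_image)
qed

section \<open>The critical points are real\<close>

definition real_critical_points :: "nat \<Rightarrow> (nat \<Rightarrow> nat) \<Rightarrow> (real \<times> real) set" where
  "real_critical_points n u = {(x, y). off_lines n (x\<^sup>2) (y\<^sup>2) \<and>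
     x * weighted_sum n u 2 (x\<^sup>2) (y\<^sup>2) = 0 \<and> y * weighted_sum n u 0 (x\<^sup>2) (y\<^sup>2) = 0}"

lemma critical_points_ellipse:
  "critical_points n ellipse u = {(x, y). off_lines n (x\<^sup>2) (y\<^sup>2) \<and>
     x * weighted_sum n u 2 (x\<^sup>2) (y\<^sup>2) = 0 \<and> y * weighted_sum n u 0 (x\<^sup>2) (y\<^sup>2) = 0}"
proof -
  have e1: "eval2 (partial1 (complexify (ellipse t))) (x, y) = 2 * x * of_nat t ^ 2" for t x y
    by (simp add: partial1_ellipse eval2_def algebra_simps)
  have e2: "eval2 (partial2 (complexify (ellipse t))) (x, y) = 2 * y" for t x y
    by (simp add: partial2_ellipse eval2_def algebra_simps)
  have "(\<Sum>t\<in>{1..n}. of_nat (u t) / line t (x\<^sup>2) (y\<^sup>2) * (2 * x * of_nat t ^ 2)) =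
      2 * (x * weighted_sum n u 2 (x\<^sup>2) (y\<^sup>2))" for x y :: complex
    unfolding weighted_sum_def sum_distrib_left by (intro sum.cong) (simp_all add: mult_ac)
  moreover have "(\<Sum>t\<in>{1..n}. of_nat (u t) / line t (x\<^sup>2) (y\<^sup>2) * (2 * y)) =
      2 * (y * weighted_sum n u 0 (x\<^sup>2) (y\<^sup>2))" for x y :: complex
    unfolding weighted_sum_def sum_distrib_left by (intro sum.cong) (simp_all add: mult_ac)
  ultimately show ?thesis
    by (simp add: critical_points_def off_lines_def eval2_complexify_ellipse e1 e2 set_eq_iff)
qed

lemma off_lines_of_real: "off_lines n (complex_of_real a) (complex_of_real b) \<longleftrightarrow> off_lines n a b"
  by (simp add: off_lines_def line_of_real)

lemma critical_points_of_real:
  "(complex_of_real x, complex_of_real y) \<in> critical_points n ellipse u \<longleftrightarrow> (x, y) \<in> real_critical_points n u"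
  unfolding critical_points_ellipse real_critical_points_def mem_Collect_eq prod.case
    of_real_power[symmetric] off_lines_of_real weighted_sum_of_real of_real_mult[symmetric] of_real_eq_0_iff ..

text \<open>
  Once \<open>X\<close> and \<open>Y\<close> are known to be real, the sign lemmas exclude negative values: \<open>X < 0\<close> would give
  \<open>A < 0\<close>, against \<open>X A = 0\<close>. So \<open>x\<close> and \<open>y\<close> are real square roots.
\<close>

lemma critical_points_real:
  assumes n: "n \<ge> 1" and u: "\<forall>t\<in>{1..n}. 0 < u t"
  shows "critical_points n ellipse u = (\<lambda>(x, y). (complex_of_real x, complex_of_real y)) ` real_critical_points n u"
proof
  show "(\<lambda>(x, y). (complex_of_real x, complex_of_real y)) ` real_critical_points n u \<subseteq> critical_points n ellipse u"
    using critical_points_of_real by auto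
  show "critical_points n ellipse u \<subseteq> (\<lambda>(x, y). (complex_of_real x, complex_of_real y)) ` real_critical_points n u"
  proof
    fix z assume z: "z \<in> critical_points n ellipse u"
    obtain x y where xy: "z = (x, y)" by (cases z)
    have off: "off_lines n (x\<^sup>2) (y\<^sup>2)" and A: "x * weighted_sum n u 2 (x\<^sup>2) (y\<^sup>2) = 0"
      and B: "y * weighted_sum n u 0 (x\<^sup>2) (y\<^sup>2) = 0"
      using z unfolding xy critical_points_ellipse by auto
    have "Im (x\<^sup>2) = 0 \<and> Im (y\<^sup>2) = 0"
      using A B by (intro critical_imp_real[OF n u off]) auto
    then obtain X Y where X: "x\<^sup>2 = complex_of_real X" and Y: "y\<^sup>2 = complex_of_real Y"
      by (metis complex_eq_iff Re_complex_of_real Im_complex_of_real)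
    have off': "off_lines n X Y" using off by (simp add: X Y off_lines_of_real)
    have W: "weighted_sum n u k (x\<^sup>2) (y\<^sup>2) = complex_of_real (weighted_sum n u k X Y)" for k
      by (simp add: X Y weighted_sum_of_real)
    have A': "X = 0 \<or> weighted_sum n u 2 X Y = 0" using A X unfolding W by auto
    have B': "Y = 0 \<or> weighted_sum n u 0 X Y = 0" using B Y unfolding W by auto
    have "X \<ge> 0" using weighted_sum_2_neg[OF n u off' _ B'] A' by force
    moreover have "Y \<ge> 0" using weighted_sum_0_neg[OF n u off' _ A'] B' by force
    moreover have "\<exists>r. w = complex_of_real r" if "w\<^sup>2 = complex_of_real W" "W \<ge> 0" for w W
    proof -
      have "w\<^sup>2 = (complex_of_real (sqrt W))\<^sup>2" using that by (simp flip: of_real_power)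
      thus ?thesis by (metis power2_eq_iff of_real_minus)
    qed
    ultimately obtain a b where ab: "x = complex_of_real a" "y = complex_of_real b" using X Y by metis
    have "(a, b) \<in> real_critical_points n u" using z critical_points_of_real by (simp add: xy ab)
    thus "z \<in> (\<lambda>(x, y). (complex_of_real x, complex_of_real y)) ` real_critical_points n u"
      unfolding xy ab by force
  qed
qed

section \<open>One critical point per bounded region\<close>

lemma region_signs:
  assumes i: "i \<in> diamond n" and z: "(x, y) \<in> region n i"
  shows "fst i = 0 \<Longrightarrow> a \<in> {1..n} \<Longrightarrow> b \<in> {1..n} \<Longrightarrow> a < b \<Longrightarrow> line a (x\<^sup>2) (y\<^sup>2) < 0 \<Longrightarrow> line b (x\<^sup>2) (y\<^sup>2) < 0"
    and "snd i = 0 \<Longrightarrow> a \<in> {1..n} \<Longrightarrow> b \<in> {1..n} \<Longrightarrow> a < b \<Longrightarrow> line a (x\<^sup>2) (y\<^sup>2) > 0 \<Longrightarrow> line b (x\<^sup>2) (y\<^sup>2) > 0"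
    and "fst i = 0 \<Longrightarrow> snd i = 0 \<Longrightarrow> a \<in> {1..n} \<Longrightarrow> line a (x\<^sup>2) (y\<^sup>2) < 0"
    and "fst i \<noteq> 0 \<Longrightarrow> 0 < of_int (fst i) * x" and "snd i \<noteq> 0 \<Longrightarrow> 0 < of_int (snd i) * y"
proof -
  obtain p q where pq: "i = (p, q)" by (cases i)
  from diamond_interval[OF i[unfolded pq]] obtain j k where
    D: "negative_indices n (p, q) = {j..k}" "1 \<le> j" "j \<le> k" "k \<le> n"
    and pq': "\<bar>p\<bar> = int (n - k)" "\<bar>q\<bar> = int (j - 1)" .
  have p0: "p = 0 \<longleftrightarrow> k = n" and q0: "q = 0 \<longleftrightarrow> j = 1" using pq' D(2-4) by auto
  have C: "(x\<^sup>2, y\<^sup>2) \<in> chamber n {j..k}" and sg: "p \<noteq> 0 \<longrightarrow> 0 < of_int p * x" "q \<noteq> 0 \<longrightarrow> 0 < of_int q * y"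
    using z unfolding pq region_def by (simp_all add: D(1))
  have neg: "line t (x\<^sup>2) (y\<^sup>2) < 0 \<longleftrightarrow> t \<in> {j..k}" and pos: "line t (x\<^sup>2) (y\<^sup>2) > 0 \<longleftrightarrow> t \<notin> {j..k}"
    if "t \<in> {1..n}" for t
  proof -
    have "if t \<in> {j..k} then line t (x\<^sup>2) (y\<^sup>2) < 0 else line t (x\<^sup>2) (y\<^sup>2) > 0"
      using C that unfolding chamber_def by blast
    thus "line t (x\<^sup>2) (y\<^sup>2) < 0 \<longleftrightarrow> t \<in> {j..k}" "line t (x\<^sup>2) (y\<^sup>2) > 0 \<longleftrightarrow> t \<notin> {j..k}"
      by (auto split: if_splits)
  qed
  show "line b (x\<^sup>2) (y\<^sup>2) < 0" if "fst i = 0" "a \<in> {1..n}" "b \<in> {1..n}" "a < b" "line a (x\<^sup>2) (y\<^sup>2) < 0"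
    using neg[of a] neg[of b] that p0 unfolding pq by simp
  show "line b (x\<^sup>2) (y\<^sup>2) > 0" if "snd i = 0" "a \<in> {1..n}" "b \<in> {1..n}" "a < b" "line a (x\<^sup>2) (y\<^sup>2) > 0"
    using pos[of a] pos[of b] that q0 unfolding pq by simp
  show "line a (x\<^sup>2) (y\<^sup>2) < 0" if "fst i = 0" "snd i = 0" "a \<in> {1..n}"
    using neg[of a] that p0 q0 unfolding pq by simp
  show "fst i \<noteq> 0 \<Longrightarrow> 0 < of_int (fst i) * x" "snd i \<noteq> 0 \<Longrightarrow> 0 < of_int (snd i) * y"
    using sg by (simp_all add: pq)
qed

text \<open>
  If a region crosses the axis \<open>x = 0\<close>, its critical points lie on that axis. Indeed the negative
  indices then run up to \<open>n\<close>, so \<open>L\<^sub>t\<close> changes sign at most once, and the critical equation \<open>y B = 0\<close>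
  yields \<open>A < 0\<close>; the axis \<open>y = 0\<close> is treated in the same way. This prevents a critical
  point and its mirror image from lying in the same region.
\<close>

lemma region_critical_point:
  assumes n: "n \<ge> 1" and u: "\<forall>t\<in>{1..n}. 0 < u t" and i: "i \<in> diamond n"
    and z: "(x, y) \<in> region n i" and crit: "(x, y) \<in> real_critical_points n u"
  shows "if fst i = 0 then x = 0 else weighted_sum n u 2 (x\<^sup>2) (y\<^sup>2) = 0"
    and "if snd i = 0 then y = 0 else weighted_sum n u 0 (x\<^sup>2) (y\<^sup>2) = 0"
proof -
  note S = region_signs[OF i z]
  have off: "off_lines n (x\<^sup>2) (y\<^sup>2)" and A: "x * weighted_sum n u 2 (x\<^sup>2) (y\<^sup>2) = 0"
    and B: "y * weighted_sum n u 0 (x\<^sup>2) (y\<^sup>2) = 0"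
    using crit by (auto simp: real_critical_points_def)
  show "if fst i = 0 then x = 0 else weighted_sum n u 2 (x\<^sup>2) (y\<^sup>2) = 0"
  proof (cases "fst i = 0")
    case True
    have "(\<forall>t\<in>{1..n}. line t (x\<^sup>2) (y\<^sup>2) < 0) \<or> weighted_sum n u 0 (x\<^sup>2) (y\<^sup>2) = 0"
      using S(3)[OF True] S(5) B by (cases "snd i = 0") auto
    hence "weighted_sum n u 2 (x\<^sup>2) (y\<^sup>2) < 0"
      using S(1)[OF True] by (intro weighted_sum_2_neg_of_signs[OF n u off]) blast+
    thus ?thesis using True A by auto
  next
    case False
    thus ?thesis using S(4) A by auto
  qed
  show "if snd i = 0 then y = 0 else weighted_sum n u 0 (x\<^sup>2) (y\<^sup>2) = 0"
  proof (cases "snd i = 0")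
    case True
    have "(\<forall>t\<in>{1..n}. line t (x\<^sup>2) (y\<^sup>2) < 0) \<or> weighted_sum n u 2 (x\<^sup>2) (y\<^sup>2) = 0"
      using S(3)[OF _ True] S(4) A by (cases "fst i = 0") auto
    hence "weighted_sum n u 0 (x\<^sup>2) (y\<^sup>2) < 0"
      using S(2)[OF True] by (intro weighted_sum_0_neg_of_signs[OF n u off]) blast+
    thus ?thesis using True B by auto
  next
    case False
    thus ?thesis using S(5) B by auto
  qed
qed

lemma diamond_1: "diamond 1 = {(0, 0)}" by (auto simp: diamond_def)

text \<open>
  A concavity argument. For two critical points in one region, the difference of the gradients
  \<open>(A, B)\<close> pairs to zero with the displacement in \<open>(X, Y)\<close>. The pairing equals
  \<open>\<Sum>t. u\<^sub>t (L'\<^sub>t - L\<^sub>t)\<^sup>2 / (L\<^sub>t L'\<^sub>t)\<close>, where all denominators are positive because corresponding values have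
  the same sign, so \<open>L\<^sub>t = L'\<^sub>t\<close> for all \<open>t\<close>. Two lines determine \<open>(X, Y)\<close>; for \<open>n = 1\<close> the only
  bounded region crosses both axes, and its critical point is the origin.
\<close>

lemma region_critical_point_unique:
  assumes n: "n \<ge> 1" and u: "\<forall>t\<in>{1..n}. 0 < u t" and i: "i \<in> diamond n"
    and z: "z \<in> region n i" "z \<in> real_critical_points n u"
    and z': "z' \<in> region n i" "z' \<in> real_critical_points n u"
  shows "z = z'"
proof -
  obtain x y where zz: "z = (x, y)" by (cases z)
  obtain x' y' where zz': "z' = (x', y')" by (cases z')
  note K = region_critical_point[OF n u i z[unfolded zz]] and K' = region_critical_point[OF n u i z'[unfolded zz']]
  define X Y X' Y' where "X = x\<^sup>2" and "Y = y\<^sup>2" and "X' = x'\<^sup>2" and "Y' = y'\<^sup>2"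
  note defs = X_def Y_def X'_def Y'_def
  have "(weighted_sum n u 2 X Y - weighted_sum n u 2 X' Y') * (X' - X) = 0"
    "(weighted_sum n u 0 X Y - weighted_sum n u 0 X' Y') * (Y' - Y) = 0"
    using K K' by (auto simp: defs split: if_splits)
  hence "0 = (weighted_sum n u 2 X Y - weighted_sum n u 2 X' Y') * (X' - X)
      + (weighted_sum n u 0 X Y - weighted_sum n u 0 X' Y') * (Y' - Y)" by (simp only: add_0)
  also have "\<dots> = (\<Sum>t\<in>{1..n}. real (u t) * (1 / line t X Y - 1 / line t X' Y') * (line t X' Y' - line t X Y))"
    unfolding weighted_sum_def sum_subtractf[symmetric] sum_distrib_right sum.distrib[symmetric]
  proof (intro sum.cong refl)
    fix t
    have d: "line t X' Y' - line t X Y = real t ^ 2 * (X' - X) + (Y' - Y)"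
      by (simp add: line_def algebra_simps)
    show "(real (u t) * real t ^ 2 / line t X Y - real (u t) * real t ^ 2 / line t X' Y') * (X' - X) +
        (real (u t) * real t ^ 0 / line t X Y - real (u t) * real t ^ 0 / line t X' Y') * (Y' - Y) =
        real (u t) * (1 / line t X Y - 1 / line t X' Y') * (line t X' Y' - line t X Y)"
      unfolding d divide_inverse by (simp add: algebra_simps)
  qed
  also have "\<dots> = (\<Sum>t\<in>{1..n}. real (u t) * (line t X' Y' - line t X Y)\<^sup>2 / (line t X Y * line t X' Y'))"
  proof (intro sum.cong refl)
    fix t assume t: "t \<in> {1..n}"
    have "line t X Y \<noteq> 0" "line t X' Y' \<noteq> 0"
      using z(2) z'(2) t by (auto simp: zz zz' real_critical_points_def off_lines_def defs)
    thus "real (u t) * (1 / line t X Y - 1 / line t X' Y') * (line t X' Y' - line t X Y) =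
        real (u t) * (line t X' Y' - line t X Y)\<^sup>2 / (line t X Y * line t X' Y')"
      by (simp add: field_simps power2_eq_square)
  qed
  finally have sum0: "(\<Sum>t\<in>{1..n}. real (u t) * (line t X' Y' - line t X Y)\<^sup>2 / (line t X Y * line t X' Y')) = 0"
    by simp
  have same_sign: "line t X Y * line t X' Y' > 0" if "t \<in> {1..n}" for t
  proof -
    have "(X, Y) \<in> chamber n (negative_indices n i)" "(X', Y') \<in> chamber n (negative_indices n i)"
      using z(1) z'(1) by (auto simp: zz zz' defs region_def split: prod.splits)
    thus ?thesis using that unfolding chamber_def
      by (cases "t \<in> negative_indices n i") (auto simp: mult_neg_neg)
  qed
  have "\<forall>t\<in>{1..n}. real (u t) * (line t X' Y' - line t X Y)\<^sup>2 / (line t X Y * line t X' Y') = 0"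
    using sum0 same_sign by (subst (asm) sum_nonneg_eq_0_iff) (auto simp: less_imp_le)
  hence eq: "line t X' Y' = line t X Y" if "t \<in> {1..n}" for t
    using that u same_sign[OF that] by fastforce
  have XY: "X = X' \<and> Y = Y'"
  proof (cases "n = 1")
    case True
    hence "i = (0, 0)" using i diamond_1 by simp
    thus ?thesis using K K' by (simp add: defs)
  next
    case False
    thus ?thesis using eq[of 1] eq[of 2] n by (simp add: line_def)
  qed
  have "x = x'"
    using XY K(1) K'(1) region_signs(4)[OF i z(1)[unfolded zz]] region_signs(4)[OF i z'(1)[unfolded zz']]
    by (cases "fst i = 0") (auto simp: defs power2_eq_iff)
  moreover have "y = y'"
    using XY K(2) K'(2) region_signs(5)[OF i z(1)[unfolded zz]] region_signs(5)[OF i z'(1)[unfolded zz']]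
    by (cases "snd i = 0") (auto simp: defs power2_eq_iff)
  ultimately show ?thesis by (simp add: zz zz')
qed

lemma DERIV_ln_square:
  fixes g :: "real \<Rightarrow> real"
  assumes "(g has_real_derivative g') (at x)" "g x \<noteq> 0"
  shows "((\<lambda>a. ln (g a ^ 2)) has_real_derivative 2 * g' / g x) (at x)"
proof -
  have "((\<lambda>a. g a ^ 2) has_real_derivative 2 * g x * g') (at x)"
    using assms(1) by (auto intro!: derivative_eq_intros)
  moreover have "0 < g x ^ 2" using assms(2) by simp
  ultimately have "((\<lambda>a. ln (g a ^ 2)) has_real_derivative inverse (g x ^ 2) * (2 * g x * g')) (at x)"
    by (intro DERIV_chain2[OF DERIV_ln])
  thus ?thesis by (rule DERIV_cong) (use assms(2) in \<open>simp add: field_simps power2_eq_square\<close>)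
qed

text \<open>
  The even powers make the objective positive off the ellipses, so that its logarithm can be
  differentiated without distinguishing the signs of the factors.
\<close>

lemma local_max_critical:
  assumes n: "n \<ge> 1" and R: "open R" "(x, y) \<in> R" and off: "\<And>a b. (a, b) \<in> R \<Longrightarrow> off_lines n (a\<^sup>2) (b\<^sup>2)"
    and max: "\<And>a b. (a, b) \<in> R \<Longrightarrow> (\<Prod>t\<in>{1..n}. (line t (a\<^sup>2) (b\<^sup>2) ^ 2) ^ u t) \<le> (\<Prod>t\<in>{1..n}. (line t (x\<^sup>2) (y\<^sup>2) ^ 2) ^ u t)"
  shows "(x, y) \<in> real_critical_points n u"
proof -
  define F where "F a b = (\<Sum>t\<in>{1..n}. real (u t) * ln (line t (a\<^sup>2) (b\<^sup>2) ^ 2))" for a b :: real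
  have F: "F a b = ln (\<Prod>t\<in>{1..n}. (line t (a\<^sup>2) (b\<^sup>2) ^ 2) ^ u t)"
    and pos: "(\<Prod>t\<in>{1..n}. (line t (a\<^sup>2) (b\<^sup>2) ^ 2) ^ u t) > 0" if "(a, b) \<in> R" for a b
  proof -
    have nz: "line t (a\<^sup>2) (b\<^sup>2) \<noteq> 0" if "t \<in> {1..n}" for t
      using off[OF \<open>(a, b) \<in> R\<close>] that by (simp add: off_lines_def)
    show "(\<Prod>t\<in>{1..n}. (line t (a\<^sup>2) (b\<^sup>2) ^ 2) ^ u t) > 0" using nz by (intro prod_pos) auto
    show "F a b = ln (\<Prod>t\<in>{1..n}. (line t (a\<^sup>2) (b\<^sup>2) ^ 2) ^ u t)"
      unfolding F_def using nz by (subst ln_prod) (auto simp: ln_realpow)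
  qed
  have le: "F a b \<le> F x y" if "(a, b) \<in> R" for a b
    using max[OF that] pos[OF that] by (simp add: F[OF that] F[OF R(2)])
  obtain e where e: "e > 0" "ball (x, y) e \<subseteq> R" using R by (meson open_contains_ball)
  have nz: "line t (x\<^sup>2) (y\<^sup>2) \<noteq> 0" if "t \<in> {1..n}" for t
    using off[OF R(2)] that by (simp add: off_lines_def)
  have "((\<lambda>a. F a y) has_real_derivative (\<Sum>t\<in>{1..n}. real (u t) * (4 * x * real t ^ 2 / line t (x\<^sup>2) (y\<^sup>2)))) (at x)"
    unfolding F_def
  proof (intro DERIV_sum DERIV_cmult)
    fix t assume t: "t \<in> {1..n}"
    have "((\<lambda>a. line t (a\<^sup>2) (y\<^sup>2)) has_real_derivative 2 * x * real t ^ 2) (at x)"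
      unfolding line_def by (auto intro!: derivative_eq_intros)
    from DERIV_ln_square[OF this nz[OF t]]
    show "((\<lambda>a. ln (line t (a\<^sup>2) (y\<^sup>2) ^ 2)) has_real_derivative 4 * x * real t ^ 2 / line t (x\<^sup>2) (y\<^sup>2)) (at x)"
      by (simp add: mult.assoc)
  qed
  moreover have "F a y \<le> F x y" if "\<bar>x - a\<bar> < e" for a
    using that e by (intro le) (auto simp: dist_Pair_Pair dist_real_def)
  ultimately have "(\<Sum>t\<in>{1..n}. real (u t) * (4 * x * real t ^ 2 / line t (x\<^sup>2) (y\<^sup>2))) = 0"
    using e(1) by (intro DERIV_local_max) auto
  moreover have "(\<Sum>t\<in>{1..n}. real (u t) * (4 * x * real t ^ 2 / line t (x\<^sup>2) (y\<^sup>2))) =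
      4 * (x * weighted_sum n u 2 (x\<^sup>2) (y\<^sup>2))"
    unfolding weighted_sum_def sum_distrib_left by (intro sum.cong) (simp_all add: mult_ac)
  ultimately have A: "x * weighted_sum n u 2 (x\<^sup>2) (y\<^sup>2) = 0" by simp
  have "((\<lambda>b. F x b) has_real_derivative (\<Sum>t\<in>{1..n}. real (u t) * (4 * y / line t (x\<^sup>2) (y\<^sup>2)))) (at y)"
    unfolding F_def
  proof (intro DERIV_sum DERIV_cmult)
    fix t assume t: "t \<in> {1..n}"
    have "((\<lambda>b. line t (x\<^sup>2) (b\<^sup>2)) has_real_derivative 2 * y) (at y)"
      unfolding line_def by (auto intro!: derivative_eq_intros)
    from DERIV_ln_square[OF this nz[OF t]]
    show "((\<lambda>b. ln (line t (x\<^sup>2) (b\<^sup>2) ^ 2)) has_real_derivative 4 * y / line t (x\<^sup>2) (y\<^sup>2)) (at y)"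
      by simp
  qed
  moreover have "F x b \<le> F x y" if "\<bar>y - b\<bar> < e" for b
    using that e by (intro le) (auto simp: dist_Pair_Pair dist_real_def)
  ultimately have "(\<Sum>t\<in>{1..n}. real (u t) * (4 * y / line t (x\<^sup>2) (y\<^sup>2))) = 0"
    using e(1) by (intro DERIV_local_max) auto
  moreover have "(\<Sum>t\<in>{1..n}. real (u t) * (4 * y / line t (x\<^sup>2) (y\<^sup>2))) =
      4 * (y * weighted_sum n u 0 (x\<^sup>2) (y\<^sup>2))"
    unfolding weighted_sum_def sum_distrib_left by (intro sum.cong) (simp_all add: mult_ac)
  ultimately have "y * weighted_sum n u 0 (x\<^sup>2) (y\<^sup>2) = 0" by simp
  with A show ?thesis using off[OF R(2)] by (simp add: real_critical_points_def)
qed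

lemma closure_region_off_lines:
  assumes i: "i \<in> diamond n" and z: "(x, y) \<in> closure (region n i)" and off: "off_lines n (x\<^sup>2) (y\<^sup>2)"
  shows "(x, y) \<in> region n i"
proof -
  have meet: "R \<inter> region n i \<noteq> {}" if "open R" "(x, y) \<in> R" for R
    using open_Int_closure_eq_empty[OF that(1), of "region n i"] that(2) z by blast
  from off_lines_region[OF off] show ?thesis
  proof
    assume "(x, y) \<in> outer_region n"
    thus ?thesis using meet[OF open_outer_region] outer_region_disjoint[OF i] by blast
  next
    assume "\<exists>i'\<in>diamond n. (x, y) \<in> region n i'"
    then obtain i' where i': "i' \<in> diamond n" "(x, y) \<in> region n i'" by blast
    then obtain w where "w \<in> region n i'" "w \<in> region n i" using meet[OF open_region] by blast
    thus ?thesis using region_disjoint[OF i'(1) i] i'(2) by blast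
  qed
qed

text \<open>
  The objective vanishes on all ellipses, hence on the boundary of the region, and is positive
  inside. So its maximum over the compact closure is attained in the region itself.
\<close>

lemma region_has_critical_point:
  assumes n: "n \<ge> 1" and u: "\<forall>t\<in>{1..n}. 0 < u t" and i: "i \<in> diamond n"
  shows "\<exists>z\<in>region n i. z \<in> real_critical_points n u"
proof -
  define h where "h z = (\<Prod>t\<in>{1..n}. (line t ((fst z)\<^sup>2) ((snd z)\<^sup>2) ^ 2) ^ u t)" for z :: "real \<times> real"
  have "continuous_on (closure (region n i)) h"
    unfolding h_def line_def by (intro continuous_intros)
  moreover have "compact (closure (region n i))" using bounded_region[OF i] by (simp add: compact_closure)
  moreover obtain w where w: "w \<in> region n i" using region_nonempty[OF i] by blast
  moreover have "region n i \<subseteq> closure (region n i)" by (rule closure_subset)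
  ultimately obtain z where z: "z \<in> closure (region n i)" "\<And>v. v \<in> closure (region n i) \<Longrightarrow> h v \<le> h z"
    using continuous_attains_sup[of "closure (region n i)" h] by blast
  obtain x y where xy: "z = (x, y)" by (cases z)
  have "h w > 0" unfolding h_def
    using region_off_lines[of "fst w" "snd w" n i] w by (intro prod_pos) (auto simp: off_lines_def)
  hence "h z > 0" using z(2)[of w] w closure_subset[of "region n i"] by fastforce
  have "off_lines n (x\<^sup>2) (y\<^sup>2)"
  proof (rule ccontr)
    assume "\<not> off_lines n (x\<^sup>2) (y\<^sup>2)"
    then obtain t where "t \<in> {1..n}" "line t (x\<^sup>2) (y\<^sup>2) = 0" unfolding off_lines_def by blast
    hence "h z = 0" using u unfolding h_def xy by (intro prod_zero bexI[of _ t]) (auto simp: zero_power)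
    thus False using \<open>h z > 0\<close> by simp
  qed
  hence R: "(x, y) \<in> region n i" using closure_region_off_lines[OF i] z(1) xy by simp
  have "(x, y) \<in> real_critical_points n u"
  proof (rule local_max_critical[OF n open_region R region_off_lines])
    fix a b assume "(a, b) \<in> region n i"
    hence "h (a, b) \<le> h (x, y)" using z(2) closure_subset[of "region n i"] xy by blast
    thus "(\<Prod>t\<in>{1..n}. (line t (a\<^sup>2) (b\<^sup>2) ^ 2) ^ u t) \<le> (\<Prod>t\<in>{1..n}. (line t (x\<^sup>2) (y\<^sup>2) ^ 2) ^ u t)"
      by (simp add: h_def)
  qed
  thus ?thesis using R by blast
qed

text \<open>
  Outside all ellipses both \<open>A\<close> and \<open>B\<close> are positive, so the critical equations would force
  \<open>x = y = 0\<close>, which lies inside them.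
\<close>

lemma critical_point_in_region:
  assumes n: "n \<ge> 1" and u: "\<forall>t\<in>{1..n}. 0 < u t" and z: "z \<in> real_critical_points n u"
  shows "\<exists>i\<in>diamond n. z \<in> region n i"
proof -
  obtain x y where xy: "z = (x, y)" by (cases z)
  have off: "off_lines n (x\<^sup>2) (y\<^sup>2)" and A: "x * weighted_sum n u 2 (x\<^sup>2) (y\<^sup>2) = 0"
    and B: "y * weighted_sum n u 0 (x\<^sup>2) (y\<^sup>2) = 0"
    using z by (auto simp: real_critical_points_def xy)
  have "(x, y) \<notin> outer_region n"
  proof
    assume "(x, y) \<in> outer_region n"
    hence pos: "\<forall>t\<in>{1..n}. line t (x\<^sup>2) (y\<^sup>2) > 0" by (auto simp: outer_region_def chamber_def)
    have "x = 0" "y = 0"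
      using weighted_sum_pos[OF n u pos, of 2] weighted_sum_pos[OF n u pos, of 0] A B by auto
    thus False using pos n by (auto simp: line_def)
  qed
  thus ?thesis using off_lines_region[OF off] xy by blast
qed

lemma card_real_critical_points:
  assumes n: "n \<ge> 1" and u: "\<forall>t\<in>{1..n}. 0 < u t"
  shows "finite (real_critical_points n u)" "card (real_critical_points n u) = 2 * n ^ 2 - 2 * n + 1"
proof -
  have "\<exists>c. \<forall>i\<in>diamond n. c i \<in> region n i \<and> c i \<in> real_critical_points n u"
    using region_has_critical_point[OF n u] by (intro bchoice) blast
  then obtain c where c: "\<And>i. i \<in> diamond n \<Longrightarrow> c i \<in> region n i"
      "\<And>i. i \<in> diamond n \<Longrightarrow> c i \<in> real_critical_points n u" by blast
  have img: "real_critical_points n u = c ` diamond n"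
  proof
    show "real_critical_points n u \<subseteq> c ` diamond n"
    proof
      fix z assume z: "z \<in> real_critical_points n u"
      then obtain i where i: "i \<in> diamond n" "z \<in> region n i" using critical_point_in_region[OF n u] by blast
      hence "z = c i" using region_critical_point_unique[OF n u i(1) i(2) z] c by blast
      thus "z \<in> c ` diamond n" using i by blast
    qed
  qed (use c in blast)
  have "inj_on c (diamond n)"
  proof (rule inj_onI)
    fix i i' assume "i \<in> diamond n" "i' \<in> diamond n" "c i = c i'"
    thus "i = i'" using region_disjoint[of i n i' "c i"] c(1)[of i] c(1)[of i'] by simp
  qed
  thus "finite (real_critical_points n u)" "card (real_critical_points n u) = 2 * n ^ 2 - 2 * n + 1"
    using card_diamond[OF n] finite_diamond by (simp_all add: img card_image)
qed

section \<open>All critical points are simple\<close>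

lemma Fract_ellipse: "Fract (complexify (ellipse t)) 1 = line t (coord1\<^sup>2) (coord2\<^sup>2)"
proof -
  have k: "(of_nat t :: complex poly2 fract) = Fract (of_nat t) 1" by (rule of_nat_fract)
  have "line t (coord1\<^sup>2) (coord2\<^sup>2) =
      Fract (of_nat t * of_nat t * ([:[:0, 1:]:] * [:[:0, 1:]:]) + [:0, 1:] * [:0, 1:] - of_nat t) 1"
    unfolding line_def k coord1_def coord2_def power2_eq_square
    by (simp only: mult_fract add_fract diff_fract mult_1 mult_1_right one_neq_zero not_False_eq_True)
  also have "of_nat t * of_nat t * ([:[:0, 1:]:] * [:[:0, 1:]:]) + [:0, 1:] * [:0, 1:] - of_nat t = complexify (ellipse t)"
    by (simp add: complexify_ellipse of_nat_poly power2_eq_square)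
  finally show ?thesis by simp
qed

lemma complexify_ellipse_nonzero: "complexify (ellipse t) \<noteq> 0"
  by (simp add: complexify_ellipse)

lemma line_coord_nonzero: "line t (coord1\<^sup>2) (coord2\<^sup>2) \<noteq> 0"
  using complexify_ellipse_nonzero[of t] by (simp add: Zero_fract_def eq_fract flip: Fract_ellipse)

lemma critical_function_ellipse:
  "critical_function partial1 n ellipse u = 2 * coord1 * weighted_sum n u 2 (coord1\<^sup>2) (coord2\<^sup>2)"
  "critical_function partial2 n ellipse u = 2 * coord2 * weighted_sum n u 0 (coord1\<^sup>2) (coord2\<^sup>2)"
proof -
  have q: "Fract p (complexify (ellipse t)) = Fract p 1 / line t (coord1\<^sup>2) (coord2\<^sup>2)" for p t
    using complexify_ellipse_nonzero by (simp flip: Fract_ellipse)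
  have k: "(of_nat m :: complex poly2 fract) = Fract (of_nat m) 1" for m by (rule of_nat_fract)
  have "Fract [:[:0, 2 * of_nat t ^ 2:]:] 1 = 2 * coord1 * of_nat t ^ 2" for t
  proof -
    have "2 * coord1 * of_nat t ^ 2 = of_nat 2 * coord1 * (of_nat t * of_nat t)"
      by (simp add: power2_eq_square)
    also have "\<dots> = Fract (of_nat 2 * [:[:0, 1:]:] * (of_nat t * of_nat t)) 1"
      unfolding k coord1_def by (simp only: mult_fract mult_1)
    also have "of_nat 2 * [:[:0, 1:]:] * (of_nat t * of_nat t) = ([:[:0, 2 * of_nat t ^ 2:]:] :: complex poly2)"
      by (simp only: of_nat_poly) (simp add: power2_eq_square)
    finally show ?thesis by simp
  qed
  thus "critical_function partial1 n ellipse u = 2 * coord1 * weighted_sum n u 2 (coord1\<^sup>2) (coord2\<^sup>2)"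
    unfolding critical_function_def weighted_sum_def sum_distrib_left
    by (intro sum.cong) (simp_all add: q partial1_ellipse)
  have "Fract [:0, 2:] 1 = 2 * coord2"
  proof -
    have "2 * coord2 = of_nat 2 * coord2" by simp
    also have "\<dots> = Fract (of_nat 2 * [:0, 1:]) 1"
      unfolding k coord2_def by (simp only: mult_fract mult_1)
    also have "of_nat 2 * [:0, 1:] = ([:0, 2:] :: complex poly2)"
      by (simp only: of_nat_poly) (simp add: numeral_poly)
    finally show ?thesis by simp
  qed
  thus "critical_function partial2 n ellipse u = 2 * coord2 * weighted_sum n u 0 (coord1\<^sup>2) (coord2\<^sup>2)"
    unfolding critical_function_def weighted_sum_def sum_distrib_left
    by (intro sum.cong) (simp_all add: q partial2_ellipse)
qed

text \<open>
  An exact first-order Taylor expansion of a weighted sum around \<open>(a, b)\<close>. The coefficients of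
  \<open>x - a\<close> and \<open>y - b\<close> still depend on \<open>x\<close> and \<open>y\<close>, which is the form that the local ring
  computation needs.
\<close>

lemma weighted_sum_expansion:
  fixes x y a b :: "'a::field" and u :: "nat \<Rightarrow> nat"
  assumes "off_lines n (x\<^sup>2) (y\<^sup>2)" "off_lines n (a\<^sup>2) (b\<^sup>2)"
  defines "T \<equiv> \<lambda>k. (\<Sum>t\<in>{1..n}. of_nat (u t) * of_nat t ^ k / (line t (x\<^sup>2) (y\<^sup>2) * line t (a\<^sup>2) (b\<^sup>2)))"
  shows "weighted_sum n u k (x\<^sup>2) (y\<^sup>2) = weighted_sum n u k (a\<^sup>2) (b\<^sup>2)
    - (x - a) * (x + a) * T (k + 2) - (y - b) * (y + b) * T k"
proof -
  have "weighted_sum n u k (x\<^sup>2) (y\<^sup>2) = (\<Sum>t\<in>{1..n}. of_nat (u t) * of_nat t ^ k / line t (a\<^sup>2) (b\<^sup>2)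
      - (x - a) * (x + a) * (of_nat (u t) * of_nat t ^ (k + 2) / (line t (x\<^sup>2) (y\<^sup>2) * line t (a\<^sup>2) (b\<^sup>2)))
      - (y - b) * (y + b) * (of_nat (u t) * of_nat t ^ k / (line t (x\<^sup>2) (y\<^sup>2) * line t (a\<^sup>2) (b\<^sup>2))))"
    unfolding weighted_sum_def
  proof (intro sum.cong refl)
    fix t assume t: "t \<in> {1..n}"
    define L M c where "L = line t (x\<^sup>2) (y\<^sup>2)" and "M = line t (a\<^sup>2) (b\<^sup>2)" and "c = (of_nat (u t) * of_nat t ^ k :: 'a)"
    have nz: "L \<noteq> 0" "M \<noteq> 0" using assms t by (auto simp: off_lines_def L_def M_def)
    have d: "M = L - (x - a) * (x + a) * of_nat t ^ 2 - (y - b) * (y + b)"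
      by (simp add: L_def M_def line_def algebra_simps power2_eq_square)
    have "c / L = c * M / (L * M)" using nz by simp
    also have "\<dots> = (c * L - (x - a) * (x + a) * (c * of_nat t ^ 2) - (y - b) * (y + b) * c) / (L * M)"
      by (subst d) (simp add: algebra_simps)
    also have "\<dots> = c / M - (x - a) * (x + a) * (c * of_nat t ^ 2 / (L * M)) - (y - b) * (y + b) * (c / (L * M))"
      using nz by (simp add: diff_divide_distrib)
    finally show "of_nat (u t) * of_nat t ^ k / line t (x\<^sup>2) (y\<^sup>2) = of_nat (u t) * of_nat t ^ k / line t (a\<^sup>2) (b\<^sup>2)
      - (x - a) * (x + a) * (of_nat (u t) * of_nat t ^ (k + 2) / (line t (x\<^sup>2) (y\<^sup>2) * line t (a\<^sup>2) (b\<^sup>2)))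
      - (y - b) * (y + b) * (of_nat (u t) * of_nat t ^ k / (line t (x\<^sup>2) (y\<^sup>2) * line t (a\<^sup>2) (b\<^sup>2)))"
      by (simp only: L_def M_def c_def power_add mult.assoc)
  qed
  thus ?thesis
    by (simp only: sum_subtractf sum_distrib_left[symmetric] T_def weighted_sum_def[of n u k "a\<^sup>2"])
qed

text \<open>
  Expanding the critical functions around the critical point and using \<open>a A(a\<^sup>2, b\<^sup>2) = 0\<close> to replace
  \<open>coord1\<close> by \<open>coord1 - a\<close> in the constant term writes them as combinations of the coordinate
  differences, with coefficients whose values at the point form the Jacobian matrix.
\<close>

lemma multiplicity_one:
  assumes n: "n \<ge> 1" and u: "\<forall>t\<in>{1..n}. 0 < u t" and crit: "(x, y) \<in> real_critical_points n u"
  shows "has_multiplicity n ellipse u (complex_of_real x, complex_of_real y) 1"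
proof -
  define \<theta> where "\<theta> = (complex_of_real x, complex_of_real y)"
  have fs: "fst \<theta> = of_real x" "snd \<theta> = of_real y" by (simp_all add: \<theta>_def)
  have off: "off_lines n (x\<^sup>2) (y\<^sup>2)" and A: "x * weighted_sum n u 2 (x\<^sup>2) (y\<^sup>2) = 0"
    and B: "y * weighted_sum n u 0 (x\<^sup>2) (y\<^sup>2) = 0"
    using crit by (auto simp: real_critical_points_def)
  define a b where "a = const_fract (fst \<theta>)" and "b = const_fract (snd \<theta>)"
  have line_ab: "line t (a\<^sup>2) (b\<^sup>2) = const_fract (of_real (line t (x\<^sup>2) (y\<^sup>2)))" for t
    unfolding line_of_real[symmetric]
    by (simp add: line_def a_def b_def fs const_fract_hom const_fract_power const_fract_of_nat)
  have ws_ab: "weighted_sum n u k (a\<^sup>2) (b\<^sup>2) = const_fract (of_real (weighted_sum n u k (x\<^sup>2) (y\<^sup>2)))" for k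
    unfolding weighted_sum_of_real[symmetric]
    by (simp add: weighted_sum_def line_ab line_of_real const_fract_sum const_fract_divide const_fract_hom
        const_fract_power const_fract_of_nat flip: of_real_power)
  have nz: "line t (x\<^sup>2) (y\<^sup>2) \<noteq> 0" if "t \<in> {1..n}" for t using off that by (simp add: off_lines_def)
  have off_ab: "off_lines n (a\<^sup>2) (b\<^sup>2)" unfolding off_lines_def line_ab
  proof
    fix t assume t: "t \<in> {1..n}"
    show "const_fract (of_real (line t (x\<^sup>2) (y\<^sup>2))) \<noteq> 0"
    proof
      assume "const_fract (of_real (line t (x\<^sup>2) (y\<^sup>2))) = 0"
      hence "complex_of_real (line t (x\<^sup>2) (y\<^sup>2)) = 0"
        using has_value_const has_value_const[of \<theta> 0] has_value_unique const_fract_hom(1) by metis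
      thus False using nz[OF t] by simp
    qed
  qed
  have off_coord: "off_lines n (coord1\<^sup>2) (coord2\<^sup>2)"
    by (simp add: off_lines_def line_coord_nonzero)
  define T where "T k = (\<Sum>t\<in>{1..n}. of_nat (u t) * of_nat t ^ k / (line t (coord1\<^sup>2) (coord2\<^sup>2) * line t (a\<^sup>2) (b\<^sup>2)))" for k
  define S where "S k = (\<Sum>t\<in>{1..n}. real (u t) * real t ^ k / line t (x\<^sup>2) (y\<^sup>2) ^ 2)" for k
  note expand = weighted_sum_expansion[OF off_coord off_ab, where u = u, folded T_def]
  have a0: "a * weighted_sum n u 2 (a\<^sup>2) (b\<^sup>2) = 0" and b0: "b * weighted_sum n u 0 (a\<^sup>2) (b\<^sup>2) = 0"
  proof -
    have "a * weighted_sum n u 2 (a\<^sup>2) (b\<^sup>2) = const_fract (of_real (x * weighted_sum n u 2 (x\<^sup>2) (y\<^sup>2)))"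
      "b * weighted_sum n u 0 (a\<^sup>2) (b\<^sup>2) = const_fract (of_real (y * weighted_sum n u 0 (x\<^sup>2) (y\<^sup>2)))"
      unfolding ws_ab by (simp_all only: a_def b_def fs const_fract_hom of_real_mult)
    thus "a * weighted_sum n u 2 (a\<^sup>2) (b\<^sup>2) = 0" "b * weighted_sum n u 0 (a\<^sup>2) (b\<^sup>2) = 0"
      unfolding A B by (simp_all add: const_fract_hom)
  qed
  have val_line: "has_value \<theta> (line t (coord1\<^sup>2) (coord2\<^sup>2)) (of_real (line t (x\<^sup>2) (y\<^sup>2)))" for t
  proof -
    have "has_value \<theta> (line t (coord1\<^sup>2) (coord2\<^sup>2)) (line t ((fst \<theta>)\<^sup>2) ((snd \<theta>)\<^sup>2))"
      unfolding line_def by (intro has_value_intros)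
    thus ?thesis by (simp add: fs line_of_real flip: of_real_power)
  qed
  have val_T: "has_value \<theta> (T k) (of_real (S k))" for k
  proof -
    have "has_value \<theta> (T k) (\<Sum>t\<in>{1..n}. of_nat (u t) * of_nat t ^ k /
        (of_real (line t (x\<^sup>2) (y\<^sup>2)) * of_real (line t (x\<^sup>2) (y\<^sup>2))))"
      unfolding T_def line_ab using nz by (intro has_value_intros val_line) auto
    thus ?thesis by (simp add: S_def power2_eq_square)
  qed
  define \<alpha> \<beta> \<gamma> \<delta> where
    "\<alpha> = 2 * weighted_sum n u 2 (a\<^sup>2) (b\<^sup>2) - 2 * coord1 * (coord1 + a) * T 4" and
    "\<beta> = - (2 * coord1 * (coord2 + b) * T 2)" and
    "\<gamma> = - (2 * coord2 * (coord1 + a) * T 2)" and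
    "\<delta> = 2 * weighted_sum n u 0 (a\<^sup>2) (b\<^sup>2) - 2 * coord2 * (coord2 + b) * T 0"
  have "has_quotient_dim (local_ring \<theta>)
      (local_ideal \<theta> (critical_function partial1 n ellipse u) (critical_function partial2 n ellipse u)) 1"
  proof (rule simple_zero_quotient_dim)
    show "has_value \<theta> \<alpha> (of_real (2 * weighted_sum n u 2 (x\<^sup>2) (y\<^sup>2) - 2 * x * (x + x) * S 4))"
      "has_value \<theta> \<beta> (of_real (- (2 * x * (y + y) * S 2)))"
      "has_value \<theta> \<gamma> (of_real (- (2 * y * (x + x) * S 2)))"
      "has_value \<theta> \<delta> (of_real (2 * weighted_sum n u 0 (x\<^sup>2) (y\<^sup>2) - 2 * y * (y + y) * S 0))"
      unfolding \<alpha>_def \<beta>_def \<gamma>_def \<delta>_def ws_ab unfolding a_def b_def of_real_mult of_real_diff of_real_add of_real_minus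
        of_real_numeral fs[symmetric]
      by (intro has_value_intros val_T)+
    have "(weighted_sum n u 2 (x\<^sup>2) (y\<^sup>2) - 2 * x\<^sup>2 * S 4) * (weighted_sum n u 0 (x\<^sup>2) (y\<^sup>2) - 2 * y\<^sup>2 * S 0)
        - (2 * x\<^sup>2 * S 2) * (2 * y\<^sup>2 * S 2) \<noteq> 0"
      unfolding S_def using A B by (intro simple_critical_det[OF n u off]) auto
    hence "(2 * weighted_sum n u 2 (x\<^sup>2) (y\<^sup>2) - 2 * x * (x + x) * S 4) *
        (2 * weighted_sum n u 0 (x\<^sup>2) (y\<^sup>2) - 2 * y * (y + y) * S 0)
        - (- (2 * x * (y + y) * S 2)) * (- (2 * y * (x + x) * S 2)) \<noteq> 0"
      by (simp add: algebra_simps power2_eq_square)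
    thus "complex_of_real (2 * weighted_sum n u 2 (x\<^sup>2) (y\<^sup>2) - 2 * x * (x + x) * S 4) *
        of_real (2 * weighted_sum n u 0 (x\<^sup>2) (y\<^sup>2) - 2 * y * (y + y) * S 0)
        - of_real (- (2 * x * (y + y) * S 2)) * of_real (- (2 * y * (x + x) * S 2)) \<noteq> 0"
      by (simp only: of_real_mult[symmetric] of_real_diff[symmetric] of_real_eq_0_iff not_False_eq_True)
    show "critical_function partial1 n ellipse u = (coord1 - const_fract (fst \<theta>)) * \<alpha> + (coord2 - const_fract (snd \<theta>)) * \<beta>"
    proof -
      have "critical_function partial1 n ellipse u =
          2 * coord1 * weighted_sum n u 2 (a\<^sup>2) (b\<^sup>2)
          - 2 * coord1 * ((coord1 - a) * (coord1 + a) * T 4 + (coord2 - b) * (coord2 + b) * T 2)"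
        unfolding critical_function_ellipse using expand[of 2] by (simp add: right_diff_distrib distrib_left)
      also have "2 * coord1 * weighted_sum n u 2 (a\<^sup>2) (b\<^sup>2) = 2 * (coord1 - a) * weighted_sum n u 2 (a\<^sup>2) (b\<^sup>2)"
        using a0 by (simp add: right_diff_distrib left_diff_distrib mult.assoc)
      finally show ?thesis
        unfolding a_def[symmetric] b_def[symmetric] \<alpha>_def \<beta>_def by (simp add: algebra_simps)
    qed
    show "critical_function partial2 n ellipse u = (coord1 - const_fract (fst \<theta>)) * \<gamma> + (coord2 - const_fract (snd \<theta>)) * \<delta>"
    proof -
      have "weighted_sum n u 0 (coord1\<^sup>2) (coord2\<^sup>2) = weighted_sum n u 0 (a\<^sup>2) (b\<^sup>2)
          - (coord1 - a) * (coord1 + a) * T 2 - (coord2 - b) * (coord2 + b) * T 0"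
        using expand[of 0] by (simp only: add_0)
      hence "critical_function partial2 n ellipse u =
          2 * coord2 * weighted_sum n u 0 (a\<^sup>2) (b\<^sup>2)
          - 2 * coord2 * ((coord1 - a) * (coord1 + a) * T 2 + (coord2 - b) * (coord2 + b) * T 0)"
        unfolding critical_function_ellipse by (simp add: right_diff_distrib distrib_left)
      also have "2 * coord2 * weighted_sum n u 0 (a\<^sup>2) (b\<^sup>2) = 2 * (coord2 - b) * weighted_sum n u 0 (a\<^sup>2) (b\<^sup>2)"
        using b0 by (simp add: right_diff_distrib left_diff_distrib mult.assoc)
      finally show ?thesis
        unfolding a_def[symmetric] b_def[symmetric] \<gamma>_def \<delta>_def by (simp add: algebra_simps)
    qed
  qed
  thus ?thesis by (simp add: has_multiplicity_def \<theta>_def)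
qed

lemma critical_count:
  assumes n: "n \<ge> 1" and u: "\<forall>t\<in>{1..n}. 0 < u t"
  shows "has_critical_count n ellipse u (2 * n ^ 2 - 2 * n + 1)"
proof -
  define \<iota> where "\<iota> = (\<lambda>(x, y). (complex_of_real x, complex_of_real y))"
  have C: "critical_points n ellipse u = \<iota> ` real_critical_points n u"
    using critical_points_real[OF n u] by (simp add: \<iota>_def)
  have "inj \<iota>" by (auto simp: \<iota>_def inj_on_def)
  hence "card (critical_points n ellipse u) = 2 * n ^ 2 - 2 * n + 1"
    unfolding C using card_real_critical_points(2)[OF n u] by (simp add: card_image inj_on_subset)
  moreover have "\<forall>\<theta>\<in>critical_points n ellipse u. has_multiplicity n ellipse u \<theta> 1"
    unfolding C \<iota>_def using multiplicity_one[OF n u] by auto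
  moreover have "finite (critical_points n ellipse u)"
    unfolding C using card_real_critical_points(1)[OF n u] by simp
  ultimately show ?thesis unfolding has_critical_count_def
    by (intro conjI exI[of _ "\<lambda>_. 1"]) simp_all
qed

lemma for_general_weightsI:
  assumes "\<And>u. \<forall>i\<in>{1..n}. 0 < u i \<Longrightarrow> Q u"
  shows "for_general_weights n Q"
  unfolding for_general_weights_def
  by (rule exI[of _ 1]) (use assms in simp)

theorem proposition11:
  fixes n :: nat
  assumes "n \<ge> 1"
  shows "\<exists>f :: nat \<Rightarrow> real poly2.
    (\<forall>i\<in>{1..n}. quadric (f i)) \<and>
    card (bounded_regions n f) = 2 * n^2 - 2 * n + 1 \<and>
    has_ML_degree n f (2 * n^2 - 2 * n + 1) \<and>
    for_general_weights n (\<lambda>u. \<forall>\<theta>\<in>critical_points n f u. fst \<theta> \<in> \<real> \<and> snd \<theta> \<in> \<real>)"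
proof (intro exI[of _ ellipse] conjI)
  show "\<forall>i\<in>{1..n}. quadric (ellipse i)" using quadric_ellipse by simp
  show "card (bounded_regions n ellipse) = 2 * n^2 - 2 * n + 1"
    using card_bounded_regions[OF assms] .
  show "has_ML_degree n ellipse (2 * n^2 - 2 * n + 1)"
    unfolding has_ML_degree_def using critical_count[OF assms] by (rule for_general_weightsI)
  show "for_general_weights n (\<lambda>u. \<forall>\<theta>\<in>critical_points n ellipse u. fst \<theta> \<in> \<real> \<and> snd \<theta> \<in> \<real>)"
    using critical_points_real[OF assms] by (intro for_general_weightsI) auto
qed

end
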